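(* Let $V:\mathbb{R}^d\to\mathbb{R}^d$ have nonempty solution set $\mathcal{X}^*=\{x\in\mathbb{R}^d: V(x)=0\}$. Assume: (1) $V$ is $L$-Lipschitz continuous: $\|V(x')-V(x)\|\le L\|x'-x\|$ for all $x,x'\in\mathbb{R}^d$; (2) there are constants $\sigma,\varkappa\ge 0$ such that, for all $t\in\{1,3/2,2,\dots\}$, the oracle noise satisfies $\mathbb{E}[Z_t\mid\mathcal{F}_t]=0$ and $\mathbb{E}[\|Z_t\|^2\mid\mathcal{F}_t]\le(\sigma+\varkappa\|X_t-x^*\|)^2$ for all $x^*\in\mathcal{X}^*$; (3) $\langle V(x),x-x^*\rangle\ge 0$ for all $x\in\mathbb{R}^d$ and $x^*\in\mathcal{X}^*$; (4) the stepsizes satisfy $\sum_t\gamma_t\eta_t=\infty$, $\sum_t\eta_t^2<\infty$ and $\sum_t\gamma_t^2\eta_t<\infty$; and suppose that $\sup_t\gamma_t<\dfrac{1}{3\max(L,\varkappa)}$. Then the iterates $X_t$ of the double stepsize extragradient algorithm converge almost surely, as $t\to\infty$ over integers, to a (possibly random) point $x^*\in\mathcal{X}^*$, i.e. a solution of $V(x^* )=0$.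
   Context: The double stepsize extragradient (DSEG) algorithm is, for integers $t=1,2,\dots$, $$X_{t+1/2}=X_t-\gamma_t\hat V_t,\qquad X_{t+1}=X_t-\eta_t\hat V_{t+1/2},$$ started at $X_1\in\mathbb{R}^d$, with deterministic stepsizes $\gamma_t\ge\eta_t>0$. For each $t\in\{1,3/2,2,\dots\}$ the stochastic oracle returns $\hat V_t=V(X_t)+Z_t$, where $Z_t$ is an additive random noise vector. $\mathcal{F}_t$ denotes the history (natural filtration), i.e. the $\sigma$-algebra generated by $X_s$, $s\le t$, $s\in\{1,3/2,2,\dots\}$. $\|\cdot\|$ is the Euclidean norm. *)

theory Defs
  imports "HOL-Probability.Probability"
begin

text \<open>
  Processes indexed by the half-integers \<open>1, 3/2, 2, \<dots>\<close> are indexed here by doubled time: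
  \<open>X k\<close> with \<open>k \<ge> 2\<close> stands for $X_{k/2}$, so integer time \<open>t\<close> is \<open>X (2 * t)\<close> and
  \<open>t + 1/2\<close> is \<open>X (2 * t + 1)\<close>.  The values at the indices 0 and 1 are irrelevant, and so
  are the stepsizes at 0.
\<close>

definition history :: "'w measure \<Rightarrow> (nat \<Rightarrow> 'w \<Rightarrow> 'a::euclidean_space) \<Rightarrow> nat \<Rightarrow> 'w measure" where
  "history M X k =
     sigma (space M) {X s -` A \<inter> space M | s A. s \<in> {2..k} \<and> A \<in> sets borel}"

text \<open>
  Only real-valued conditional expectation is in the library; for random vectors it is taken
  coordinatewise.
\<close>

definition vec_cond_exp ::
  "'w measure \<Rightarrow> 'w measure \<Rightarrow> ('w \<Rightarrow> 'a::euclidean_space) \<Rightarrow> 'w \<Rightarrow> 'a" where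
  "vec_cond_exp M F f = (\<lambda>\<omega>. \<Sum>b\<in>Basis. real_cond_exp M F (\<lambda>\<omega>. f \<omega> \<bullet> b) \<omega> *\<^sub>R b)"

definition oracle_feedback ::
  "('a \<Rightarrow> 'a) \<Rightarrow> (nat \<Rightarrow> 'w \<Rightarrow> 'a) \<Rightarrow> (nat \<Rightarrow> 'w \<Rightarrow> 'a) \<Rightarrow> nat \<Rightarrow> 'w \<Rightarrow> 'a::euclidean_space" where
  "oracle_feedback V X Z k \<omega> = V (X k \<omega>) + Z k \<omega>"

text \<open>
  The starting point may be any random vector; a deterministic one is the constant case.
  Measurability of the later iterates follows from that of \<open>X 2\<close>, of the noise and of \<open>V\<close>.
\<close>

definition dseg ::
  "'w measure \<Rightarrow> ('a \<Rightarrow> 'a) \<Rightarrow> (nat \<Rightarrow> real) \<Rightarrow> (nat \<Rightarrow> real) \<Rightarrow>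
   (nat \<Rightarrow> 'w \<Rightarrow> 'a) \<Rightarrow> (nat \<Rightarrow> 'w \<Rightarrow> 'a::euclidean_space) \<Rightarrow> bool" where
  "dseg M V \<gamma> \<eta> Z X \<longleftrightarrow>
     X 2 \<in> borel_measurable M \<and>
     (\<forall>k\<ge>2. Z k \<in> borel_measurable M) \<and>
     (\<forall>t\<ge>1. \<forall>\<omega>\<in>space M.
        X (2 * t + 1) \<omega> = X (2 * t) \<omega> - \<gamma> t *\<^sub>R oracle_feedback V X Z (2 * t) \<omega> \<and>
        X (2 * (t + 1)) \<omega> = X (2 * t) \<omega> - \<eta> t *\<^sub>R oracle_feedback V X Z (2 * t + 1) \<omega>)"

text \<open>
  The second moment uses the \<open>ennreal\<close>-valued conditional expectation, so that the bound is not
  met vacuously by a non-integrable function.  As the bound is finite, it also makes the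
  conditional expectation of the noise well defined.
\<close>

definition oracle_noise ::
  "'w measure \<Rightarrow> 'a set \<Rightarrow> real \<Rightarrow> real \<Rightarrow>
   (nat \<Rightarrow> 'w \<Rightarrow> 'a) \<Rightarrow> (nat \<Rightarrow> 'w \<Rightarrow> 'a::euclidean_space) \<Rightarrow> bool" where
  "oracle_noise M S \<sigma> \<kappa> Z X \<longleftrightarrow>
     (\<forall>k\<ge>2.
        (AE \<omega> in M. vec_cond_exp M (history M X k) (Z k) \<omega> = 0) \<and>
        (\<forall>x\<in>S. AE \<omega> in M.
           nn_cond_exp M (history M X k) (\<lambda>\<omega>. ennreal ((norm (Z k \<omega>))\<^sup>2)) \<omega>
             \<le> ennreal ((\<sigma> + \<kappa> * norm (X k \<omega> - x))\<^sup>2)))"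

end

theory Submission
  imports Defs
begin

text \<open>
  The proof follows the squared distance \<open>D\<^sub>t\<close> of the iterate \<open>X\<^sub>t\<close> to a fixed solution \<open>p\<close>.
  Because the exploration step is at least as long as the update step, one round of the algorithm
  decreases \<open>D\<^sub>t\<close> in conditional mean by a multiple of \<open>\<gamma>\<^sub>t \<eta>\<^sub>t (norm (V X\<^sub>t))\<^sup>2\<close>, up to errors
  \<open>e\<^sub>t (1 + D\<^sub>t)\<close> caused by the noise, where \<open>e\<^sub>t\<close> is of order \<open>\<gamma>\<^sub>t\<^sup>2 \<eta>\<^sub>t + \<eta>\<^sub>t\<^sup>2\<close> and therefore
  summable.  The deterministic core of this is lemma \<open>dseg_descent\<close>, its conditional form lemma
  \<open>dseg_one_step\<close>.
  
  Such an almost-supermartingale converges almost surely, and its decrements are summable: this is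
  the theorem of Robbins and Siegmund (lemma \<open>robbins_siegmund\<close>), which is reduced to the convergence
  of nonnegative supermartingales, and the latter to an upcrossing inequality.  Hence, almost surely,
  the distances of \<open>X\<^sub>t\<close> to \<open>p\<close> converge and \<open>\<Sum>t. \<gamma>\<^sub>t \<eta>\<^sub>t (norm (V X\<^sub>t))\<^sup>2\<close> is finite.
  
  As \<open>\<Sum>t. \<gamma>\<^sub>t \<eta>\<^sub>t\<close> diverges, \<open>V X\<^sub>t\<close> comes arbitrarily close to \<open>0\<close>, so some cluster point of the
  bounded sequence \<open>X\<^sub>t\<close> is a solution.  Convergence of the distances to all points of a countable
  dense set of solutions then forces the whole sequence to converge to that cluster point (lemma
  \<open>convergent_if_quasi_fejer\<close>).
  
  The starting point, and with it every iterate, may have infinite moments.  The one-step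
  inequalities are therefore inequalities between nonnegative integrals over events of the history,
  proved first on events on which the current iterate is bounded.
\<close>

section \<open>Convergence of nonnegative supermartingales\<close>

definition discrete_filtration :: "'w measure \<Rightarrow> (nat \<Rightarrow> 'w measure) \<Rightarrow> bool" where
  "discrete_filtration M F \<longleftrightarrow> (\<forall>n. subalgebra M (F n)) \<and> (\<forall>n. subalgebra (F (Suc n)) (F n))"

lemma filtration_mono:
  assumes "discrete_filtration M F" "m \<le> n"
  shows "subalgebra (F n) (F m)"
  using assms(2)
proof (induction rule: dec_induct)
  case base
  show ?case by (simp add: subalgebra_def)
next
  case (step n)
  have "subalgebra (F (Suc n)) (F n)" using assms(1) by (simp add: discrete_filtration_def)
  with step.IH show ?case by (auto simp: subalgebra_def)
qed

lemma filtration_measurable: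
  assumes "discrete_filtration M F" "m \<le> n" "f \<in> borel_measurable (F m)"
  shows "f \<in> borel_measurable (F n)"
  using measurable_from_subalg[OF filtration_mono[OF assms(1,2)] assms(3)] .

lemma filtration_measurable_top:
  assumes "discrete_filtration M F" "f \<in> borel_measurable (F m)"
  shows "f \<in> borel_measurable M"
  using measurable_from_subalg assms by (metis discrete_filtration_def)

lemma filtration_sets_top:
  assumes "discrete_filtration M F" "A \<in> sets (F m)"
  shows "A \<in> sets M"
  using assms by (auto simp: discrete_filtration_def subalgebra_def)

text \<open>
  The upcrossings of the band from \<open>a\<close> to \<open>b\<close> are counted by a trader who buys one share when the
  price \<open>u\<close> is below \<open>a\<close> and sells it when the price is above \<open>b\<close>; every sale is one completed
  upcrossing.  Both functions at time \<open>n\<close> look only at \<open>u 0, \<dots>, u n\<close>, so that along a process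
  \<open>holding\<close> is a legitimate, adapted, strategy.
\<close>

fun holding :: "real \<Rightarrow> real \<Rightarrow> (nat \<Rightarrow> real) \<Rightarrow> nat \<Rightarrow> bool" where
  "holding a b u 0 \<longleftrightarrow> u 0 < a"
| "holding a b u (Suc n) \<longleftrightarrow> (if holding a b u n then u (Suc n) \<le> b else u (Suc n) < a)"

fun sales :: "real \<Rightarrow> real \<Rightarrow> (nat \<Rightarrow> real) \<Rightarrow> nat \<Rightarrow> nat" where
  "sales a b u 0 = 0"
| "sales a b u (Suc n) = sales a b u n + (if holding a b u n \<and> u (Suc n) > b then 1 else 0)"

lemma sales_mono: "m \<le> n \<Longrightarrow> sales a b u m \<le> sales a b u n"
  by (rule lift_Suc_mono_le[of "sales a b u"]) auto

lemma sales_unbounded: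
  assumes low: "\<exists>\<^sub>F n in sequentially. u n < a"
    and high: "\<exists>\<^sub>F n in sequentially. u n > b"
  shows "\<exists>n. sales a b u n \<ge> k"
proof (induction k)
  case 0
  show ?case by simp
next
  case (Suc k)
  then obtain n where n: "sales a b u n \<ge> k" by blast
  obtain m where m: "m \<ge> n" "holding a b u m"
  proof (cases "holding a b u n")
    case True
    then show ?thesis using that by blast
  next
    case False
    obtain j where j: "j \<ge> Suc n" "u j < a"
      using low by (meson frequently_sequentially)
    then obtain i where i: "j = Suc i" "i \<ge> n" by (metis Suc_le_D Suc_le_mono)
    show ?thesis
    proof (cases "holding a b u i")
      case True
      then show ?thesis using that i by blast
    next
      case False
      then have "holding a b u j" using i j by simp
      then show ?thesis using that[of j] i by simp
    qed
  qed
  have "\<exists>j\<ge>m. holding a b u j \<and> u (Suc j) > b"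
  proof (rule ccontr)
    assume none: "\<not> ?thesis"
    have hold: "holding a b u j" if "j \<ge> m" for j
      using that
    proof (induction rule: dec_induct)
      case base
      show ?case by (rule m)
    next
      case (step j)
      then show ?case using none by force
    qed
    obtain j where j: "j \<ge> Suc m" "u j > b" using high by (meson frequently_sequentially)
    then obtain i where "j = Suc i" "i \<ge> m" by (metis Suc_le_D Suc_le_mono)
    with j none hold show False by blast
  qed
  then obtain j where j: "j \<ge> m" "holding a b u j" "u (Suc j) > b" by blast
  have "sales a b u (Suc j) \<ge> Suc k" using sales_mono[of n j a b u] j m n by simp
  then show ?case by blast
qed

lemma measurable_holding:
  fixes U :: "nat \<Rightarrow> 'w \<Rightarrow> real"
  assumes "\<And>k. k \<le> n \<Longrightarrow> U k \<in> borel_measurable N"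
  shows "Measurable.pred N (\<lambda>\<omega>. holding a b (\<lambda>n. U n \<omega>) n)"
  using assms
proof (induction n)
  case 0
  then have [measurable]: "U 0 \<in> borel_measurable N" by simp
  show ?case by simp
next
  case (Suc n)
  then have [measurable]: "U (Suc n) \<in> borel_measurable N"
      "Measurable.pred N (\<lambda>\<omega>. holding a b (\<lambda>n. U n \<omega>) n)" by simp_all
  show ?case by simp
qed

lemma measurable_sales:
  fixes U :: "nat \<Rightarrow> 'w \<Rightarrow> real"
  assumes U[measurable]: "\<And>n. U n \<in> borel_measurable N"
  shows "(\<lambda>\<omega>. real (sales a b (\<lambda>n. U n \<omega>) n)) \<in> borel_measurable N"
proof (induction n)
  case (Suc n)
  note [measurable] = Suc measurable_holding[OF U]
  show ?case by simp
qed simp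

text \<open>
  A sequence without a limit in the extended reals has its lower limit strictly below its upper
  limit, hence crosses some band with rational ends infinitely often.  Rational bands suffice, and
  there are countably many of them, so null sets can be collected later.
\<close>

lemma convergent_if_no_oscillation:
  fixes u :: "nat \<Rightarrow> real"
  assumes nonneg: "\<And>n. 0 \<le> u n"
    and fin: "\<exists>\<^sub>F n in sequentially. u n \<le> C"
    and osc: "\<And>p q :: rat. p < q \<Longrightarrow> 0 < p \<Longrightarrow>
      \<exists>k. \<forall>n. sales (of_rat p) (of_rat q) u n \<le> k"
  shows "convergent u"
proof -
  let ?x = "\<lambda>n. ereal (u n)"
  have l0: "0 \<le> liminf ?x"
    by (rule Liminf_bounded) (simp add: nonneg)
  have "\<not> liminf ?x < limsup ?x"
  proof
    assume "liminf ?x < limsup ?x"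
    then obtain p where p: "liminf ?x < ereal (of_rat p)" "ereal (of_rat p) < limsup ?x"
      using ereal_dense3 by blast
    then obtain q where q: "ereal (of_rat p) < ereal (of_rat q)" "ereal (of_rat q) < limsup ?x"
      using ereal_dense3 by blast
    have "\<exists>\<^sub>F n in sequentially. u n < of_rat p"
    proof (rule ccontr)
      assume "\<not> ?thesis"
      then have "\<forall>\<^sub>F n in sequentially. ereal (of_rat p) \<le> ?x n"
        by (simp add: not_frequently not_less)
      then have "ereal (of_rat p) \<le> liminf ?x" by (rule Liminf_bounded)
      with p show False by simp
    qed
    moreover have "\<exists>\<^sub>F n in sequentially. u n > of_rat q"
    proof (rule ccontr)
      assume "\<not> ?thesis"
      then have "\<forall>\<^sub>F n in sequentially. ?x n \<le> ereal (of_rat q)"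
        by (simp add: not_frequently not_less)
      then have "limsup ?x \<le> ereal (of_rat q)" by (rule Limsup_bounded)
      with q show False by simp
    qed
    moreover have "p < q" using q by (simp add: of_rat_less)
    moreover have "0 < p"
    proof -
      have "0 < ereal (of_rat p)" using l0 p(1) by (rule le_less_trans)
      then show ?thesis by simp
    qed
    ultimately show False using osc sales_unbounded by (metis Suc_n_not_le_n order_trans)
  qed
  then have eq: "limsup ?x = liminf ?x"
    using Liminf_le_Limsup[of sequentially ?x] by (auto simp: not_less intro: antisym)
  have "liminf ?x \<noteq> \<infinity>"
  proof
    assume "liminf ?x = \<infinity>"
    then have "\<forall>\<^sub>F n in sequentially. ereal C < ?x n" by (intro less_LiminfD) simp
    with fin show False by (simp add: frequently_def not_le)
  qed
  then obtain l where l: "liminf ?x = ereal l" using l0 by (cases "liminf ?x") auto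
  have "?x \<longlonglongrightarrow> ereal l"
    using eq l by (intro Liminf_eq_Limsup) auto
  then show ?thesis by (auto simp: convergent_def)
qed

text \<open>
  Doob's upcrossing inequality, in Dubins' manner by pasting supermartingales together: while the
  trader holds the share, count its price \<open>U n\<close>, and otherwise count \<open>a\<close>; add \<open>b - a\<close> for every
  past sale.  At a purchase the price is below the \<open>a\<close> that it replaces, at a sale it is above the
  \<open>(b - a) + a\<close> that replaces it.  Thus this nonnegative quantity is a supermartingale that
  starts at most at \<open>a\<close>, and it dominates \<open>b - a\<close> times the number of sales.
\<close>

lemma upcrossing_inequality:
  fixes U :: "nat \<Rightarrow> 'w \<Rightarrow> real"
  assumes filt: "discrete_filtration M F"
    and adapted: "\<And>n. U n \<in> borel_measurable (F n)"
    and nonneg: "\<And>n \<omega>. 0 \<le> U n \<omega>"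
    and super: "\<And>n A. A \<in> sets (F n) \<Longrightarrow>
      (\<integral>\<^sup>+\<omega>\<in>A. ennreal (U (Suc n) \<omega>) \<partial>M) \<le> (\<integral>\<^sup>+\<omega>\<in>A. ennreal (U n \<omega>) \<partial>M)"
    and ab: "0 < a" "a < b"
  shows "(\<integral>\<^sup>+\<omega>. ennreal ((b - a) * real (sales a b (\<lambda>n. U n \<omega>) n)) \<partial>M)
    \<le> ennreal a * emeasure M (space M)"
proof -
  let ?H = "\<lambda>n \<omega>. holding a b (\<lambda>n. U n \<omega>) n"
  let ?N = "\<lambda>n \<omega>. real (sales a b (\<lambda>n. U n \<omega>) n)"
  have H: "Measurable.pred (F n) (?H n)" for n
    by (rule measurable_holding) (rule filtration_measurable[OF filt _ adapted])
  have UM[measurable]: "U n \<in> borel_measurable M" for n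
    by (rule filtration_measurable_top[OF filt adapted])
  have [measurable]: "Measurable.pred M (?H n)" for n by (rule measurable_holding) (rule UM)
  have NM[measurable]: "?N n \<in> borel_measurable M" for n by (rule measurable_sales) (rule UM)
  have spF: "space (F n) = space M" for n using filt by (simp add: discrete_filtration_def subalgebra_def)
  define \<Phi> where "\<Phi> n \<omega> = (b - a) * ?N n \<omega> + (if ?H n \<omega> then U n \<omega> else a)" for n \<omega>
  \<comment> \<open>what \<open>\<Phi> n\<close> counts besides the share in hand; adding that share at its next price bounds \<open>\<Phi> (Suc n)\<close>\<close>
  define R where "R n \<omega> = (b - a) * ?N n \<omega> + (if ?H n \<omega> then 0 else a)" for n \<omega>
  have [measurable]: "R n \<in> borel_measurable M" for n unfolding R_def by measurable
  have R0: "0 \<le> R n \<omega>" for n \<omega> using ab by (simp add: R_def)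
  define A where "A n = {\<omega> \<in> space M. ?H n \<omega>}" for n
  have AF: "A n \<in> sets (F n)" for n using H[of n] spF by (simp add: A_def pred_def)
  then have AM[measurable]: "A n \<in> sets M" for n by (rule filtration_sets_top[OF filt])
  have "(\<integral>\<^sup>+\<omega>. ennreal (\<Phi> n \<omega>) \<partial>M) \<le> ennreal a * emeasure M (space M)" for n
  proof (induction n)
    case 0
    have "(\<integral>\<^sup>+\<omega>. ennreal (\<Phi> 0 \<omega>) \<partial>M) \<le> (\<integral>\<^sup>+\<omega>. ennreal a \<partial>M)"
      by (intro nn_integral_mono ennreal_leI) (auto simp: \<Phi>_def)
    then show ?case by simp
  next
    case (Suc n)
    have "(\<integral>\<^sup>+\<omega>. ennreal (\<Phi> (Suc n) \<omega>) \<partial>M)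
        \<le> (\<integral>\<^sup>+\<omega>. ennreal (R n \<omega>) + ennreal (U (Suc n) \<omega>) * indicator (A n) \<omega> \<partial>M)"
    proof (rule nn_integral_mono)
      fix \<omega> assume w: "\<omega> \<in> space M"
      have "\<Phi> (Suc n) \<omega> \<le> R n \<omega> + (if ?H n \<omega> then U (Suc n) \<omega> else 0)"
        using ab by (auto simp: \<Phi>_def R_def algebra_simps)
      then have "ennreal (\<Phi> (Suc n) \<omega>)
          \<le> ennreal (R n \<omega> + (if ?H n \<omega> then U (Suc n) \<omega> else 0))" by (rule ennreal_leI)
      also have "\<dots> = ennreal (R n \<omega>) + ennreal (U (Suc n) \<omega>) * indicator (A n) \<omega>"
        using w R0 nonneg by (auto simp: ennreal_plus A_def indicator_def)
      finally show "ennreal (\<Phi> (Suc n) \<omega>) \<le> \<dots>" .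
    qed
    also have "\<dots> = (\<integral>\<^sup>+\<omega>. ennreal (R n \<omega>) \<partial>M) + (\<integral>\<^sup>+\<omega>\<in>A n. ennreal (U (Suc n) \<omega>) \<partial>M)"
      by (rule nn_integral_add) simp_all
    also have "\<dots> \<le> (\<integral>\<^sup>+\<omega>. ennreal (R n \<omega>) \<partial>M) + (\<integral>\<^sup>+\<omega>\<in>A n. ennreal (U n \<omega>) \<partial>M)"
      by (intro add_left_mono super AF)
    also have "\<dots> = (\<integral>\<^sup>+\<omega>. ennreal (R n \<omega>) + ennreal (U n \<omega>) * indicator (A n) \<omega> \<partial>M)"
      by (rule nn_integral_add[symmetric]) simp_all
    also have "\<dots> = (\<integral>\<^sup>+\<omega>. ennreal (\<Phi> n \<omega>) \<partial>M)"
    proof (rule nn_integral_cong)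
      fix \<omega> assume w: "\<omega> \<in> space M"
      have "\<Phi> n \<omega> = R n \<omega> + (if ?H n \<omega> then U n \<omega> else 0)"
        by (auto simp: \<Phi>_def R_def)
      then show "ennreal (R n \<omega>) + ennreal (U n \<omega>) * indicator (A n) \<omega> = ennreal (\<Phi> n \<omega>)"
        using w R0 nonneg by (auto simp: ennreal_plus A_def indicator_def)
    qed
    also note Suc.IH
    finally show ?case .
  qed
  moreover have "(\<integral>\<^sup>+\<omega>. ennreal ((b - a) * ?N n \<omega>) \<partial>M) \<le> (\<integral>\<^sup>+\<omega>. ennreal (\<Phi> n \<omega>) \<partial>M)"
    using ab nonneg by (intro nn_integral_mono ennreal_leI) (auto simp: \<Phi>_def)
  ultimately show ?thesis by (rule order_trans[rotated])
qed

lemma AE_bounded_if_incseq_integral_bounded: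
  fixes f :: "nat \<Rightarrow> 'w \<Rightarrow> real"
  assumes [measurable]: "\<And>n. f n \<in> borel_measurable M"
    and inc: "\<And>n \<omega>. f n \<omega> \<le> f (Suc n) \<omega>"
    and bound: "\<And>n. (\<integral>\<^sup>+\<omega>. ennreal (f n \<omega>) \<partial>M) \<le> C" and "C < \<infinity>"
  shows "AE \<omega> in M. \<exists>K. \<forall>n. f n \<omega> \<le> K"
proof -
  have "incseq (\<lambda>n \<omega>. ennreal (f n \<omega>))"
    by (auto intro!: incseq_SucI le_funI ennreal_leI inc)
  then have "(\<integral>\<^sup>+\<omega>. (SUP n. ennreal (f n \<omega>)) \<partial>M) = (SUP n. \<integral>\<^sup>+\<omega>. ennreal (f n \<omega>) \<partial>M)"
    by (rule nn_integral_monotone_convergence_SUP) simp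
  also have "\<dots> \<le> C" by (rule SUP_least) (rule bound)
  finally have "(\<integral>\<^sup>+\<omega>. (SUP n. ennreal (f n \<omega>)) \<partial>M) \<noteq> \<infinity>" using \<open>C < \<infinity>\<close> by (auto simp: top_unique)
  then have "AE \<omega> in M. (SUP n. ennreal (f n \<omega>)) \<noteq> \<infinity>"
    by (rule nn_integral_PInf_AE[rotated]) simp
  then show ?thesis
  proof (rule AE_mp, intro AE_I2 impI)
    fix \<omega> assume fin: "(SUP n. ennreal (f n \<omega>)) \<noteq> \<infinity>"
    then obtain K where K: "(SUP n. ennreal (f n \<omega>)) = ennreal K" "0 \<le> K"
      by (cases "SUP n. ennreal (f n \<omega>)") (auto simp: top_ennreal_def)
    have "f n \<omega> \<le> K" for n
    proof -
      have "ennreal (f n \<omega>) \<le> ennreal K" unfolding K(1)[symmetric] by (rule SUP_upper) simp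
      then show ?thesis using K(2) by simp
    qed
    then show "\<exists>K. \<forall>n. f n \<omega> \<le> K" by blast
  qed
qed

text \<open>
  The upcrossing inequality bounds the expected number of upcrossings of each band uniformly in
  time, so almost surely no rational band is crossed infinitely often.  That the limit is finite
  comes from Fatou's lemma and the nonincreasing expectations.
\<close>

lemma nonneg_supermartingale_convergent:
  fixes U :: "nat \<Rightarrow> 'w \<Rightarrow> real"
  assumes fm: "finite_measure M" and filt: "discrete_filtration M F"
    and adapted: "\<And>n. U n \<in> borel_measurable (F n)"
    and nonneg: "\<And>n \<omega>. 0 \<le> U n \<omega>"
    and super: "\<And>n A. A \<in> sets (F n) \<Longrightarrow>
      (\<integral>\<^sup>+\<omega>\<in>A. ennreal (U (Suc n) \<omega>) \<partial>M) \<le> (\<integral>\<^sup>+\<omega>\<in>A. ennreal (U n \<omega>) \<partial>M)"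
    and init: "(\<integral>\<^sup>+\<omega>. ennreal (U 0 \<omega>) \<partial>M) < \<infinity>"
  shows "AE \<omega> in M. convergent (\<lambda>n. U n \<omega>)"
proof -
  interpret finite_measure M by (rule fm)
  have UM[measurable]: "U n \<in> borel_measurable M" for n
    by (rule filtration_measurable_top[OF filt adapted])
  have spF: "space M \<in> sets (F n)" for n
    using filt sets.top[of "F n"] by (simp add: discrete_filtration_def subalgebra_def)
  have bounded: "(\<integral>\<^sup>+\<omega>. ennreal (U n \<omega>) \<partial>M) \<le> (\<integral>\<^sup>+\<omega>. ennreal (U 0 \<omega>) \<partial>M)" for n
  proof (induction n)
    case (Suc n)
    then show ?case using super[OF spF, of n] by simp
  qed simp
  have sales_AE: "AE \<omega> in M. p < q \<longrightarrow> 0 < p \<longrightarrow>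
      (\<exists>k. \<forall>n. sales (of_rat p) (of_rat q) (\<lambda>n. U n \<omega>) n \<le> k)" for p q :: rat
  proof (cases "p < q \<and> 0 < p")
    case True
    let ?a = "real_of_rat p" and ?b = "real_of_rat q"
    have ab: "0 < ?a" "?a < ?b" using True by (auto simp: of_rat_less)
    let ?N = "\<lambda>n \<omega>. (?b - ?a) * real (sales ?a ?b (\<lambda>n. U n \<omega>) n)"
    have [measurable]: "(\<lambda>\<omega>. real (sales ?a ?b (\<lambda>n. U n \<omega>) n)) \<in> borel_measurable M" for n
      by (rule measurable_sales) (rule UM)
    have "AE \<omega> in M. \<exists>K. \<forall>n. ?N n \<omega> \<le> K"
    proof (rule AE_bounded_if_incseq_integral_bounded)
      show "?N n \<in> borel_measurable M" for n by measurable
      show "?N n \<omega> \<le> ?N (Suc n) \<omega>" for n \<omega>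
        using ab sales_mono[of n "Suc n" ?a ?b "\<lambda>n. U n \<omega>"] by (intro mult_left_mono) auto
      show "(\<integral>\<^sup>+\<omega>. ennreal (?N n \<omega>) \<partial>M) \<le> ennreal ?a * emeasure M (space M)" for n
        by (rule upcrossing_inequality[OF filt adapted nonneg super ab])
      show "ennreal ?a * emeasure M (space M) < \<infinity>"
        using emeasure_finite[of "space M"] by (simp add: ennreal_mult_eq_top_iff less_top[symmetric])
    qed
    then show ?thesis
    proof (rule AE_mp, intro AE_I2 impI)
      fix \<omega> assume "\<exists>K. \<forall>n. ?N n \<omega> \<le> K"
      then obtain K where "\<And>n. ?N n \<omega> \<le> K" by blast
      then have "real (sales ?a ?b (\<lambda>n. U n \<omega>) n) \<le> K / (?b - ?a)" for n
        using ab by (simp add: pos_le_divide_eq mult.commute)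
      then have "sales ?a ?b (\<lambda>n. U n \<omega>) n \<le> nat \<lfloor>K / (?b - ?a)\<rfloor>" for n
        by (simp add: le_nat_floor)
      then show "\<exists>k. \<forall>n. sales ?a ?b (\<lambda>n. U n \<omega>) n \<le> k" by blast
    qed
  qed auto
  have all_sales: "AE \<omega> in M. \<forall>p q :: rat. p < q \<longrightarrow> 0 < p \<longrightarrow>
      (\<exists>k. \<forall>n. sales (of_rat p) (of_rat q) (\<lambda>n. U n \<omega>) n \<le> k)"
    unfolding AE_all_countable by (intro allI sales_AE)
  have "(\<integral>\<^sup>+\<omega>. liminf (\<lambda>n. ennreal (U n \<omega>)) \<partial>M) \<le> liminf (\<lambda>n. \<integral>\<^sup>+\<omega>. ennreal (U n \<omega>) \<partial>M)"
    by (rule nn_integral_liminf) simp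
  also have "\<dots> \<le> limsup (\<lambda>n. \<integral>\<^sup>+\<omega>. ennreal (U n \<omega>) \<partial>M)"
    by (rule Liminf_le_Limsup) simp
  also have "\<dots> \<le> (\<integral>\<^sup>+\<omega>. ennreal (U 0 \<omega>) \<partial>M)"
    by (rule Limsup_bounded) (simp add: bounded)
  also note init
  finally have "(\<integral>\<^sup>+\<omega>. liminf (\<lambda>n. ennreal (U n \<omega>)) \<partial>M) \<noteq> \<infinity>" by simp
  then have fin: "AE \<omega> in M. liminf (\<lambda>n. ennreal (U n \<omega>)) \<noteq> \<infinity>"
    by (rule nn_integral_PInf_AE[rotated]) simp
  from all_sales fin show ?thesis
  proof eventually_elim
    case (elim \<omega>)
    then obtain C where C: "liminf (\<lambda>n. ennreal (U n \<omega>)) = ennreal C" "0 \<le> C"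
      by (cases "liminf (\<lambda>n. ennreal (U n \<omega>))") (auto simp: top_ennreal_def)
    have "\<exists>\<^sub>F n in sequentially. U n \<omega> \<le> C + 1"
    proof (rule ccontr)
      assume "\<not> ?thesis"
      then have "\<forall>\<^sub>F n in sequentially. ennreal (C + 1) \<le> ennreal (U n \<omega>)"
        by (auto simp: not_frequently not_le elim!: eventually_mono intro: ennreal_leI)
      then have "ennreal (C + 1) \<le> ennreal C" unfolding C(1)[symmetric] by (rule Liminf_bounded)
      then show False using C(2) by simp
    qed
    then show ?case
      by (rule convergent_if_no_oscillation[rotated]) (use nonneg elim(1) in blast)+
  qed
qed

section \<open>Almost-supermartingales\<close>

lemma nn_integral_affine_mono:
  fixes f g r :: "'w \<Rightarrow> real"
  assumes [measurable]: "f \<in> borel_measurable M" "g \<in> borel_measurable M" "r \<in> borel_measurable M"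
      "B \<in> sets M"
    and nonneg: "\<And>\<omega>. 0 \<le> f \<omega>" "\<And>\<omega>. 0 \<le> g \<omega>" "\<And>\<omega>. 0 \<le> r \<omega>" "0 \<le> c"
    and le: "(\<integral>\<^sup>+\<omega>\<in>B. ennreal (f \<omega>) \<partial>M) \<le> (\<integral>\<^sup>+\<omega>\<in>B. ennreal (g \<omega>) \<partial>M)"
  shows "(\<integral>\<^sup>+\<omega>\<in>B. ennreal (c * f \<omega> + r \<omega>) \<partial>M) \<le> (\<integral>\<^sup>+\<omega>\<in>B. ennreal (c * g \<omega> + r \<omega>) \<partial>M)"
proof -
  have expand: "(\<integral>\<^sup>+\<omega>\<in>B. ennreal (c * h \<omega> + r \<omega>) \<partial>M)
      = ennreal c * (\<integral>\<^sup>+\<omega>\<in>B. ennreal (h \<omega>) \<partial>M) + (\<integral>\<^sup>+\<omega>\<in>B. ennreal (r \<omega>) \<partial>M)"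
    if [measurable]: "h \<in> borel_measurable M" and h0: "\<And>\<omega>. 0 \<le> h \<omega>" for h :: "'w \<Rightarrow> real"
  proof -
    have "(\<integral>\<^sup>+\<omega>\<in>B. ennreal (c * h \<omega> + r \<omega>) \<partial>M)
        = (\<integral>\<^sup>+\<omega>. ennreal c * (ennreal (h \<omega>) * indicator B \<omega>) + ennreal (r \<omega>) * indicator B \<omega> \<partial>M)"
      using nonneg h0 by (intro nn_integral_cong)
        (auto simp: ennreal_plus ennreal_mult indicator_def)
    also have "\<dots> = ennreal c * (\<integral>\<^sup>+\<omega>\<in>B. ennreal (h \<omega>) \<partial>M) + (\<integral>\<^sup>+\<omega>\<in>B. ennreal (r \<omega>) \<partial>M)"
      by (subst nn_integral_add) (auto simp: nn_integral_cmult)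
    finally show ?thesis .
  qed
  show ?thesis
    unfolding expand[OF assms(1) nonneg(1)] expand[OF assms(2) nonneg(2)]
    by (intro add_right_mono mult_left_mono le) simp
qed

text \<open>
  The Robbins--Siegmund theorem.  Dividing by \<open>a n = (\<Prod>k<n. 1 + e k)\<close> removes the multiplicative
  perturbation; adding the accumulated \<open>P\<close> and the tail of the deterministic additive errors turns
  \<open>D n / a n\<close> into a nonnegative supermartingale.  Its limit exists; the accumulated \<open>P\<close> is monotone
  and, like the whole process, bounded, hence converges, and so does the remainder \<open>D n / a n\<close>.
  Since \<open>a\<close> converges and is bounded, the factors can be removed again.
  
  \<open>D 0\<close> may have infinite expectation: the argument is run on each event \<open>D 0 \<le> N\<close>, which belongs
  to every \<open>F n\<close>, and these events exhaust the space.
\<close>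

lemma robbins_siegmund:
  fixes D P :: "nat \<Rightarrow> 'w \<Rightarrow> real" and e :: "nat \<Rightarrow> real"
  assumes fm: "finite_measure M" and filt: "discrete_filtration M F"
    and D: "\<And>n. D n \<in> borel_measurable (F n)" and P: "\<And>n. P n \<in> borel_measurable (F n)"
    and D0: "\<And>n \<omega>. 0 \<le> D n \<omega>" and P0: "\<And>n \<omega>. 0 \<le> P n \<omega>"
    and e0: "\<And>n. 0 \<le> e n" and e: "summable e"
    and step: "\<And>n A. A \<in> sets (F n) \<Longrightarrow>
      (\<integral>\<^sup>+\<omega>\<in>A. ennreal (D (Suc n) \<omega> + P n \<omega>) \<partial>M)
        \<le> (\<integral>\<^sup>+\<omega>\<in>A. ennreal ((1 + e n) * D n \<omega> + e n) \<partial>M)"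
  shows "AE \<omega> in M. convergent (\<lambda>n. D n \<omega>) \<and> summable (\<lambda>n. P n \<omega>)"
proof -
  interpret finite_measure M by (rule fm)
  note [measurable] = filtration_measurable_top[OF filt D] filtration_measurable_top[OF filt P]
  define a where "a n = (\<Prod>k<n. 1 + e k)" for n
  have a_Suc: "a (Suc n) = a n * (1 + e n)" for n by (simp add: a_def)
  have a1: "1 \<le> a n" for n unfolding a_def by (rule prod_ge_1) (simp add: e0)
  have a_pos: "0 < a n" for n using a1[of n] by linarith
  have a_le: "a n \<le> exp (suminf e)" for n
  proof -
    have "a n \<le> exp (\<Sum>k<n. e k)" unfolding a_def by (rule prod_le_exp_sum) (rule e0)
    also have "\<dots> \<le> exp (suminf e)" using sum_le_suminf[OF e] e0 by simp
    finally show ?thesis .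
  qed
  have "incseq a"
  proof (rule incseq_SucI)
    show "a n \<le> a (Suc n)" for n using a_pos[of n] e0[of n] by (simp add: a_Suc algebra_simps)
  qed
  then obtain l where l: "a \<longlonglongrightarrow> l" using incseq_convergent a_le by blast
  \<comment> \<open>subtracting the errors from their total bound keeps the compensated process nonnegative\<close>
  define T where "T n = suminf e - (\<Sum>k<n. e k / a (Suc k))" for n
  have ea: "e k / a (Suc k) \<le> e k" for k
    using mult_left_mono[OF a1[of "Suc k"] e0[of k]] a_pos[of "Suc k"] by (simp add: divide_le_eq)
  have T0: "0 \<le> T n" for n
  proof -
    have "(\<Sum>k<n. e k / a (Suc k)) \<le> (\<Sum>k<n. e k)" by (rule sum_mono) (rule ea)
    also have "\<dots> \<le> suminf e" using sum_le_suminf[OF e] e0 by simp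
    finally show ?thesis by (simp add: T_def)
  qed
  have "summable (\<lambda>k. e k / a (Suc k))"
    by (rule summable_comparison_test[OF _ e]) (use ea e0 a_pos in \<open>auto simp: abs_of_nonneg less_imp_le\<close>)
  then have T_conv: "convergent T"
    unfolding T_def summable_iff_convergent by (intro convergent_diff convergent_const)
  define S where "S n \<omega> = (\<Sum>k<n. P k \<omega> / a (Suc k))" for n \<omega>
  have S0: "0 \<le> S n \<omega>" for n \<omega>
    unfolding S_def using P0 a_pos by (intro sum_nonneg) (simp add: less_imp_le)
  have SF: "S n \<in> borel_measurable (F n)" for n
    unfolding S_def
    by (intro borel_measurable_sum borel_measurable_divide borel_measurable_const
          filtration_measurable[OF filt _ P]) auto
  note [measurable] = filtration_measurable_top[OF filt SF]
  define B where "B N = {\<omega> \<in> space M. D 0 \<omega> \<le> real N}" for N :: nat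
  have spF: "space (F n) = space M" for n
    using filt by (simp add: discrete_filtration_def subalgebra_def)
  have BF: "B N \<in> sets (F n)" for N n
  proof -
    note filtration_measurable[OF filt _ D, of 0 n, measurable]
    have "{\<omega> \<in> space (F n). D 0 \<omega> \<le> real N} \<in> sets (F n)" by measurable
    then show ?thesis by (simp add: B_def spF)
  qed
  note [measurable] = filtration_sets_top[OF filt BF]
  define U where "U N n \<omega> = indicator (B N) \<omega> * (D n \<omega> / a n + S n \<omega> + T n)" for N n \<omega>
  have conv: "AE \<omega> in M. convergent (\<lambda>n. U N n \<omega>)" for N
  proof (rule nonneg_supermartingale_convergent[OF fm filt])
    fix n
    note D[measurable] SF[measurable] BF[measurable]
    show "U N n \<in> borel_measurable (F n)" unfolding U_def by measurable
    show "0 \<le> U N n \<omega>" for \<omega>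
      using D0[of n \<omega>] a_pos[of n] S0[of n \<omega>] T0[of n] by (simp add: U_def)
    fix A assume A: "A \<in> sets (F n)"
    have AB: "A \<inter> B N \<in> sets (F n)" using A BF by blast
    define r where "r \<omega> = S n \<omega> + T (Suc n)" for \<omega>
    have [measurable]: "r \<in> borel_measurable M" unfolding r_def by measurable
    have ind: "(\<integral>\<^sup>+\<omega>\<in>A. ennreal (indicator (B N) \<omega> * h \<omega>) \<partial>M)
        = (\<integral>\<^sup>+\<omega>\<in>A \<inter> B N. ennreal (h \<omega>) \<partial>M)" for h :: "'w \<Rightarrow> real"
      by (intro nn_integral_cong) (auto simp: indicator_def)
    have next_eq: "D (Suc n) \<omega> / a (Suc n) + S (Suc n) \<omega> + T (Suc n)
        = 1 / a (Suc n) * (D (Suc n) \<omega> + P n \<omega>) + r \<omega>" for \<omega>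
      by (simp add: S_def r_def add_divide_distrib)
    have this_eq: "D n \<omega> / a n + S n \<omega> + T n
        = 1 / a (Suc n) * ((1 + e n) * D n \<omega> + e n) + r \<omega>" for \<omega>
    proof -
      have "1 / a (Suc n) * ((1 + e n) * D n \<omega> + e n) = D n \<omega> / a n + e n / a (Suc n)"
        using a_pos[of n] e0[of n] unfolding a_Suc mult.commute[of "a n"]
        by (simp add: add_divide_distrib)
      moreover have "T n = T (Suc n) + e n / a (Suc n)" by (simp add: T_def)
      ultimately show ?thesis by (simp add: r_def)
    qed
    show "(\<integral>\<^sup>+\<omega>\<in>A. ennreal (U N (Suc n) \<omega>) \<partial>M) \<le> (\<integral>\<^sup>+\<omega>\<in>A. ennreal (U N n \<omega>) \<partial>M)"
      unfolding U_def ind next_eq this_eq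
    proof (rule nn_integral_affine_mono)
      show "A \<inter> B N \<in> sets M" by (rule filtration_sets_top[OF filt AB])
      show "0 \<le> D (Suc n) \<omega> + P n \<omega>" for \<omega> by (simp add: D0 P0)
      show "0 \<le> (1 + e n) * D n \<omega> + e n" for \<omega> by (simp add: D0 e0)
      show "0 \<le> r \<omega>" for \<omega> by (simp add: r_def S0 T0)
      show "0 \<le> 1 / a (Suc n)" using a_pos[of "Suc n"] by simp
    qed (use step[OF AB] in \<open>simp_all\<close>)
  next
    have "(\<integral>\<^sup>+\<omega>. ennreal (U N 0 \<omega>) \<partial>M) \<le> (\<integral>\<^sup>+\<omega>. ennreal (real N + suminf e) \<partial>M)"
    proof (intro nn_integral_mono ennreal_leI)
      fix \<omega>
      have "0 \<le> suminf e" using e e0 by (rule suminf_nonneg)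
      then show "U N 0 \<omega> \<le> real N + suminf e"
        by (auto simp: U_def a_def S_def T_def B_def indicator_def)
    qed
    also have "\<dots> < \<infinity>" using emeasure_finite[of "space M"]
      by (simp add: ennreal_mult_eq_top_iff less_top[symmetric])
    finally show "(\<integral>\<^sup>+\<omega>. ennreal (U N 0 \<omega>) \<partial>M) < \<infinity>" .
  qed
  then have "AE \<omega> in M. \<forall>N. convergent (\<lambda>n. U N n \<omega>)" by (simp add: AE_all_countable)
  then show ?thesis
  proof (rule AE_mp, intro AE_I2 impI)
    fix \<omega> assume w: "\<omega> \<in> space M" and all: "\<forall>N. convergent (\<lambda>n. U N n \<omega>)"
    obtain N :: nat where "D 0 \<omega> \<le> real N" using real_arch_simple by blast
    then have eq: "U N n \<omega> = D n \<omega> / a n + S n \<omega> + T n" for n using w by (simp add: U_def B_def)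
    have "convergent (\<lambda>n. D n \<omega> / a n + S n \<omega> + T n)" using all[rule_format, of N] unfolding eq .
    from convergent_diff[OF this T_conv] have DS: "convergent (\<lambda>n. D n \<omega> / a n + S n \<omega>)" by simp
    then obtain K where K: "\<And>n. \<bar>D n \<omega> / a n + S n \<omega>\<bar> \<le> K"
      using convergent_imp_Bseq[OF DS] by (auto simp: Bseq_def)
    have SK: "S n \<omega> \<le> K" for n
    proof -
      have "0 \<le> D n \<omega> / a n" using D0 a_pos by (simp add: less_imp_le)
      then show ?thesis using K[of n] by linarith
    qed
    have "incseq (\<lambda>n. S n \<omega>)"
      by (rule incseq_SucI) (simp add: S_def P0 a_pos less_imp_le)
    then have S_conv: "convergent (\<lambda>n. S n \<omega>)"
      using incseq_convergent[of "\<lambda>n. S n \<omega>" K] SK unfolding convergent_def by metis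
    from convergent_diff[OF DS S_conv] have "convergent (\<lambda>n. D n \<omega> / a n)" by simp
    moreover have "convergent a" using l by (auto simp: convergent_def)
    ultimately have "convergent (\<lambda>n. D n \<omega> / a n * a n)" by (rule convergent_mult)
    moreover have "D n \<omega> / a n * a n = D n \<omega>" for n using a_pos[of n] by simp
    ultimately have "convergent (\<lambda>n. D n \<omega>)" by simp
    moreover have "summable (\<lambda>n. P n \<omega>)"
    proof (rule summable_comparison_test)
      have "summable (\<lambda>k. P k \<omega> / a (Suc k))" using S_conv unfolding S_def summable_iff_convergent .
      then show "summable (\<lambda>k. exp (suminf e) * (P k \<omega> / a (Suc k)))" by (rule summable_mult)
      have "P k \<omega> \<le> exp (suminf e) * (P k \<omega> / a (Suc k))" for k
        using mult_right_mono[OF a_le[of "Suc k"] P0[of k \<omega>]] a_pos[of "Suc k"]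
        by (simp add: field_simps)
      then show "\<exists>N. \<forall>n\<ge>N. norm (P n \<omega>) \<le> exp (suminf e) * (P n \<omega> / a (Suc n))"
        using P0 by simp
    qed
    ultimately show "convergent (\<lambda>n. D n \<omega>) \<and> summable (\<lambda>n. P n \<omega>)" by blast
  qed
qed

section \<open>Sequences with convergent distances to the zeros of a map\<close>

lemma summable_weights_frequently_small:
  fixes w f :: "nat \<Rightarrow> real"
  assumes div: "filterlim (\<lambda>n. \<Sum>k<n. w k) at_top sequentially"
    and w: "\<And>n. 0 \<le> w n" and sm: "summable (\<lambda>n. w n * f n)" and "0 < c"
  shows "\<exists>n\<ge>m. f n < c"
proof (rule ccontr)
  assume "\<not> ?thesis"
  then have ge: "c \<le> f n" if "m \<le> n" for n using that by force
  have "summable (\<lambda>n. w n * f n / c)" by (intro summable_divide sm)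
  then have "summable w"
  proof (rule summable_comparison_test'[where N = m])
    fix n assume "m \<le> n"
    then have "w n * c \<le> w n * f n" using ge w by (intro mult_left_mono) auto
    then show "norm (w n) \<le> w n * f n / c" using w \<open>0 < c\<close> by (simp add: field_simps)
  qed
  then have "(\<lambda>n. \<Sum>k<n. w k) \<longlonglongrightarrow> suminf w" by (rule summable_LIMSEQ)
  with div show False using not_tendsto_and_filterlim_at_infinity filterlim_at_top_imp_at_infinity
    by (metis trivial_limit_sequentially)
qed

text \<open>
  Opial's argument.  The sequence is bounded, and a subsequence along which \<open>g (x n)\<close> tends to \<open>0\<close>
  has a cluster point \<open>z\<close>, a zero of \<open>g\<close>.  For a point \<open>c\<close> of \<open>C\<close> near \<open>z\<close> the distances to \<open>c\<close>
  converge, and along the subsequence their limit is the small number \<open>norm (z - c)\<close>; so the whole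
  sequence is eventually near \<open>c\<close>, and hence near \<open>z\<close>.  Asking for convergent distances only on a
  dense subset \<open>C\<close> of the zeros allows \<open>C\<close> to be countable.
\<close>

lemma convergent_if_quasi_fejer:
  fixes x :: "nat \<Rightarrow> 'a::euclidean_space" and g :: "'a \<Rightarrow> 'b::real_normed_vector"
  assumes cont: "continuous_on UNIV g"
    and dense: "C \<noteq> {}" "{z. g z = 0} \<subseteq> closure C"
    and dist: "\<And>c. c \<in> C \<Longrightarrow> convergent (\<lambda>n. norm (x n - c))"
    and small: "\<And>c m. 0 < c \<Longrightarrow> \<exists>n\<ge>m. norm (g (x n)) < c"
  shows "\<exists>z. g z = 0 \<and> x \<longlonglongrightarrow> z"
proof -
  obtain c where c: "c \<in> C" using dense by blast
  then obtain K where K: "\<And>n. norm (x n - c) \<le> K"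
    using convergent_imp_Bseq[OF dist[OF c]] by (auto simp: Bseq_def)
  have "\<exists>n\<ge>m. norm (g (x n)) < inverse (real (Suc m))" for m by (rule small) simp
  then obtain t where t: "\<And>m. t m \<ge> m" "\<And>m. norm (g (x (t m))) < inverse (real (Suc m))"
    by metis
  have "compact (cball c K)" by simp
  moreover have "(x \<circ> t) n \<in> cball c K" for n using K by (simp add: dist_norm norm_minus_commute)
  ultimately obtain z s where s: "strict_mono s" and z: "(x \<circ> t \<circ> s) \<longlonglongrightarrow> z"
    unfolding compact_def by metis
  have ts: "filterlim (\<lambda>n. t (s n)) at_top sequentially"
  proof (rule filterlim_at_top_mono)
    show "filterlim (\<lambda>n. n) at_top sequentially" by (rule filterlim_ident)
    show "\<forall>\<^sub>F n in sequentially. n \<le> t (s n)"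
      using seq_suble[OF s] t(1) by (intro always_eventually allI) (meson order_trans)
  qed
  have "(\<lambda>n. g (x (t (s n)))) \<longlonglongrightarrow> g z"
    using continuous_on_tendsto_compose[OF cont z] by (simp add: o_def)
  moreover have "(\<lambda>n. g (x (t (s n)))) \<longlonglongrightarrow> 0"
  proof (rule Lim_null_comparison)
    show "\<forall>\<^sub>F n in sequentially. norm (g (x (t (s n)))) \<le> inverse (real (Suc (s n)))"
      using t(2) by (intro always_eventually allI) (rule less_imp_le)
    show "(\<lambda>n. inverse (real (Suc (s n)))) \<longlonglongrightarrow> 0"
      using LIMSEQ_subseq_LIMSEQ[OF LIMSEQ_inverse_real_of_nat s] by (simp add: o_def)
  qed
  ultimately have gz: "g z = 0" using LIMSEQ_unique by blast
  have "x \<longlonglongrightarrow> z"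
  proof (rule LIMSEQ_I)
    fix \<delta> :: real assume "0 < \<delta>"
    then obtain c where c: "c \<in> C" "dist c z < \<delta> / 2"
      using gz dense(2) closure_approachable[of z C] half_gt_zero by blast
    obtain l where l: "(\<lambda>n. norm (x n - c)) \<longlonglongrightarrow> l" using dist[OF c(1)] by (auto simp: convergent_def)
    have "(\<lambda>n. norm (x (t (s n)) - c)) \<longlonglongrightarrow> l" using filterlim_compose[OF l ts] .
    moreover have "(\<lambda>n. norm (x (t (s n)) - c)) \<longlonglongrightarrow> norm (z - c)"
      using z by (intro tendsto_intros) (simp add: o_def)
    ultimately have "l = norm (z - c)" using LIMSEQ_unique by blast
    then have "l < \<delta> / 2" using c by (simp add: dist_norm norm_minus_commute)
    then have "\<forall>\<^sub>F n in sequentially. norm (x n - c) < \<delta> / 2" using l by (rule order_tendstoD(2)[rotated])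
    then obtain m where m: "\<And>n. m \<le> n \<Longrightarrow> norm (x n - c) < \<delta> / 2"
      by (auto simp: eventually_sequentially)
    have "norm (x n - z) < \<delta>" if "m \<le> n" for n
      using norm_triangle_ineq[of "x n - c" "c - z"] m[OF that] c by (simp add: dist_norm)
    then show "\<exists>m. \<forall>n\<ge>m. norm (x n - z) < \<delta>" by blast
  qed
  with gz show ?thesis by blast
qed

section \<open>One round of the double stepsize extragradient method\<close>

lemma norm_add_power2_le:
  fixes u v :: "'a::real_inner"
  shows "(norm (u + v))\<^sup>2 \<le> 2 * (norm u)\<^sup>2 + 2 * (norm v)\<^sup>2"
  using zero_le_power2[of "norm (u - v)"] unfolding power2_norm_eq_inner
  by (simp add: inner_diff_left inner_diff_right inner_add_left inner_add_right inner_commute)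

lemma norm_diff_power2_le:
  fixes u v :: "'a::real_inner"
  shows "(norm (u - v))\<^sup>2 \<le> 2 * (norm u)\<^sup>2 + 2 * (norm v)\<^sup>2"
  using norm_add_power2_le[of u "- v"] by simp

text \<open>
  The pathwise energy estimate of one step.  Since \<open>x - p = (y - p) + \<gamma> (V x + z)\<close> and
  \<open>V y \<bullet> (y - p) \<ge> 0\<close>, the update direction \<open>V y\<close> has at least the correlation \<open>\<gamma> V y \<bullet> (V x + z)\<close>
  with \<open>x - p\<close>.  Polarisation of \<open>V y \<bullet> V x\<close> yields \<open>- \<gamma> \<eta> (norm (V x))\<^sup>2\<close>, the desired decrease,
  and \<open>- \<gamma> \<eta> (norm (V y))\<^sup>2\<close>, which absorbs the second-order term \<open>\<eta>\<^sup>2 (norm (V y))\<^sup>2\<close> because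
  \<open>\<eta> \<le> \<gamma>\<close>.  The price is \<open>(norm (V y - V x))\<^sup>2\<close>, which is controlled by \<open>\<gamma> L \<le> 1/3\<close>.
  
  As \<open>y\<close> depends on the noise \<open>z\<close>, the product \<open>V y \<bullet> z\<close> is not centred; it is compared with
  \<open>V (x - \<gamma> V x) \<bullet> z\<close>, where the noiseless half step depends only on the past of \<open>z\<close>.
\<close>

lemma dseg_descent:
  fixes V :: "'a::real_inner \<Rightarrow> 'a"
  assumes lip: "L-lipschitz_on UNIV V"
    and p: "V p = 0" "\<And>x. V x \<bullet> (x - p) \<ge> 0"
    and step: "0 < \<eta>" "\<eta> \<le> \<gamma>" "\<gamma> * L \<le> 1 / 3"
    and y: "y = x - \<gamma> *\<^sub>R (V x + z)" and x': "x' = x - \<eta> *\<^sub>R (V y + z')"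
  shows "(norm (x' - p))\<^sup>2 + \<gamma> * \<eta> / 2 * (norm (V x))\<^sup>2
    \<le> (norm (x - p))\<^sup>2 - 2 * \<gamma> * \<eta> * (V (x - \<gamma> *\<^sub>R V x) \<bullet> z)
      - 2 * \<eta> * ((x - p - \<eta> *\<^sub>R V y) \<bullet> z')
      + 3 * L * \<gamma>\<^sup>2 * \<eta> * (norm z)\<^sup>2 + \<eta>\<^sup>2 * (norm z')\<^sup>2"
proof -
  define a b c where "a = V x" and "b = V y" and "c = V (x - \<gamma> *\<^sub>R V x)"
  have L0: "0 \<le> L" by (rule lipschitz_on_nonneg[OF lip])
  have g0: "0 < \<gamma>" using step by linarith
  have Lip: "norm (V u - V v) \<le> L * norm (u - v)" for u v
    using lipschitz_onD[OF lip] by (simp add: dist_norm)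
  have expand: "(norm (x' - p))\<^sup>2 = (norm (x - p))\<^sup>2 - 2 * \<eta> * (b \<bullet> (x - p))
      + \<eta>\<^sup>2 * (norm b)\<^sup>2 - 2 * \<eta> * ((x - p - \<eta> *\<^sub>R b) \<bullet> z') + \<eta>\<^sup>2 * (norm z')\<^sup>2"
  proof -
    have "x' - p = (x - p) - \<eta> *\<^sub>R (b + z')" by (simp add: x' b_def)
    then show ?thesis
      unfolding power2_norm_eq_inner
      by (simp only:) (simp add: inner_diff_left inner_diff_right inner_add_left inner_add_right
          inner_commute algebra_simps power2_eq_square)
  qed
  have mono: "\<gamma> * (b \<bullet> a) + \<gamma> * (b \<bullet> z) \<le> b \<bullet> (x - p)"
  proof -
    have "x - p = (y - p) + \<gamma> *\<^sub>R (a + z)" by (simp add: y a_def)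
    then have "b \<bullet> (x - p) = b \<bullet> (y - p) + \<gamma> * (b \<bullet> a) + \<gamma> * (b \<bullet> z)"
      by (simp only:) (simp add: inner_add_right algebra_simps)
    then show ?thesis using p(2)[of y] by (simp add: b_def)
  qed
  have polar: "2 * (b \<bullet> a) = (norm a)\<^sup>2 + (norm b)\<^sup>2 - (norm (b - a))\<^sup>2"
    unfolding power2_norm_eq_inner by (simp add: inner_diff_left inner_diff_right inner_commute)
  have ba: "(norm (b - a))\<^sup>2 \<le> 2 / 9 * (norm a)\<^sup>2 + 2 / 3 * (L * \<gamma>) * (norm z)\<^sup>2"
  proof -
    have Lg: "0 \<le> L * \<gamma>" "L * \<gamma> \<le> 1 / 3" using L0 g0 step by (auto simp: mult.commute)
    have "norm (b - a) \<le> L * norm (y - x)" unfolding a_def b_def by (rule Lip)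
    also have "norm (y - x) = \<gamma> * norm (a + z)" using g0 by (simp add: y a_def)
    finally have "(norm (b - a))\<^sup>2 \<le> (L * \<gamma> * norm (a + z))\<^sup>2"
      by (intro power_mono) (simp_all add: mult.assoc)
    also have "\<dots> \<le> (L * \<gamma>)\<^sup>2 * (2 * (norm a)\<^sup>2 + 2 * (norm z)\<^sup>2)"
      unfolding power_mult_distrib by (intro mult_left_mono norm_add_power2_le) simp
    also have "\<dots> = (L * \<gamma>)\<^sup>2 * (2 * (norm a)\<^sup>2) + (L * \<gamma>)\<^sup>2 * (2 * (norm z)\<^sup>2)"
      by (simp add: algebra_simps)
    also have "\<dots> \<le> (1 / 9) * (2 * (norm a)\<^sup>2) + (L * \<gamma> / 3) * (2 * (norm z)\<^sup>2)"
    proof (intro add_mono mult_right_mono)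
      show "(L * \<gamma>)\<^sup>2 \<le> 1 / 9" using power_mono[OF Lg(2) Lg(1), of 2] by (simp add: power2_eq_square)
      show "(L * \<gamma>)\<^sup>2 \<le> L * \<gamma> / 3" using mult_left_mono[OF Lg(2) Lg(1)] by (simp add: power2_eq_square)
    qed auto
    finally show ?thesis by simp
  qed
  have cb: "(c - b) \<bullet> z \<le> L * \<gamma> * (norm z)\<^sup>2"
  proof -
    have "(c - b) \<bullet> z \<le> norm (c - b) * norm z" by (rule norm_cauchy_schwarz)
    also have "norm (c - b) \<le> L * norm ((x - \<gamma> *\<^sub>R V x) - y)" unfolding b_def c_def by (rule Lip)
    also have "(x - \<gamma> *\<^sub>R V x) - y = \<gamma> *\<^sub>R z" by (simp add: y algebra_simps)
    also have "L * norm (\<gamma> *\<^sub>R z) = L * \<gamma> * norm z" using g0 by simp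
    finally show ?thesis by (simp add: mult_right_mono power2_eq_square mult.assoc)
  qed
  have split: "b \<bullet> z = c \<bullet> z - (c - b) \<bullet> z" by (simp add: inner_diff_left)
  have 1: "\<eta> * (\<gamma> * (norm a)\<^sup>2 + \<gamma> * (norm b)\<^sup>2 - \<gamma> * (2 / 9 * (norm a)\<^sup>2 + 2 / 3 * (L * \<gamma>) * (norm z)\<^sup>2)
      + 2 * \<gamma> * (c \<bullet> z) - 2 * \<gamma> * (L * \<gamma> * (norm z)\<^sup>2)) \<le> \<eta> * (2 * (b \<bullet> (x - p)))"
  proof (rule mult_left_mono)
    have "\<gamma> * (norm (b - a))\<^sup>2 \<le> \<gamma> * (2 / 9 * (norm a)\<^sup>2 + 2 / 3 * (L * \<gamma>) * (norm z)\<^sup>2)"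
      using ba g0 by (intro mult_left_mono) auto
    moreover have "\<gamma> * ((c - b) \<bullet> z) \<le> \<gamma> * (L * \<gamma> * (norm z)\<^sup>2)"
      using cb g0 by (intro mult_left_mono) auto
    moreover have "\<gamma> * (2 * (b \<bullet> a)) = \<gamma> * (norm a)\<^sup>2 + \<gamma> * (norm b)\<^sup>2 - \<gamma> * (norm (b - a))\<^sup>2"
      unfolding polar by (simp add: algebra_simps)
    moreover have "\<gamma> * (b \<bullet> z) = \<gamma> * (c \<bullet> z) - \<gamma> * ((c - b) \<bullet> z)"
      unfolding split by (simp add: algebra_simps)
    ultimately show "\<gamma> * (norm a)\<^sup>2 + \<gamma> * (norm b)\<^sup>2
        - \<gamma> * (2 / 9 * (norm a)\<^sup>2 + 2 / 3 * (L * \<gamma>) * (norm z)\<^sup>2)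
        + 2 * \<gamma> * (c \<bullet> z) - 2 * \<gamma> * (L * \<gamma> * (norm z)\<^sup>2) \<le> 2 * (b \<bullet> (x - p))"
      using mono by linarith
  qed (use step in simp)
  have 2: "\<eta>\<^sup>2 * (norm b)\<^sup>2 \<le> \<gamma> * \<eta> * (norm b)\<^sup>2"
    using step by (intro mult_right_mono) (auto simp: power2_eq_square)
  have 3: "0 \<le> \<gamma> * \<eta> * (norm a)\<^sup>2" using g0 step by simp
  have 4: "0 \<le> L * \<gamma>\<^sup>2 * \<eta> * (norm z)\<^sup>2" using L0 step by simp
  have 5: "\<eta> * (\<gamma> * (norm a)\<^sup>2 + \<gamma> * (norm b)\<^sup>2
      - \<gamma> * (2 / 9 * (norm a)\<^sup>2 + 2 / 3 * (L * \<gamma>) * (norm z)\<^sup>2)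
      + 2 * \<gamma> * (c \<bullet> z) - 2 * \<gamma> * (L * \<gamma> * (norm z)\<^sup>2))
    = 7 / 9 * (\<gamma> * \<eta> * (norm a)\<^sup>2) + \<gamma> * \<eta> * (norm b)\<^sup>2
      - 8 / 3 * (L * \<gamma>\<^sup>2 * \<eta> * (norm z)\<^sup>2) + 2 * (\<gamma> * \<eta> * (c \<bullet> z))"
    by (simp add: algebra_simps power2_eq_square)
  have "(norm (x' - p))\<^sup>2 + \<gamma> * \<eta> / 2 * (norm a)\<^sup>2
    \<le> (norm (x - p))\<^sup>2 - 2 * \<gamma> * \<eta> * (c \<bullet> z) - 2 * \<eta> * ((x - p - \<eta> *\<^sub>R b) \<bullet> z')
      + 3 * L * \<gamma>\<^sup>2 * \<eta> * (norm z)\<^sup>2 + \<eta>\<^sup>2 * (norm z')\<^sup>2"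
    using 1[unfolded 5] 2 3 4 unfolding expand by (simp add: mult.assoc)
  then show ?thesis by (simp only: a_def b_def c_def)
qed

text \<open>
  Coordinatewise, a known factor \<open>W\<close> may be moved out of the conditional expectation.  Restriction
  to an event \<open>A\<close> of \<open>F\<close> is built in because \<open>W\<close> and \<open>Z\<close> are guaranteed to be square
  integrable only on events that bound the current iterate.
\<close>

lemma noise_orthogonal:
  fixes W Z :: "'w \<Rightarrow> 'a::euclidean_space"
  assumes sub: "sigma_finite_subalgebra M F" and A: "A \<in> sets F"
    and W: "W \<in> borel_measurable F" and Z: "Z \<in> borel_measurable M"
    and mean: "AE \<omega> in M. vec_cond_exp M F Z \<omega> = 0"
    and W2: "integrable M (\<lambda>\<omega>. indicator A \<omega> * (norm (W \<omega>))\<^sup>2)"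
    and Z2: "integrable M (\<lambda>\<omega>. indicator A \<omega> * (norm (Z \<omega>))\<^sup>2)"
  shows "integrable M (\<lambda>\<omega>. indicator A \<omega> * (W \<omega> \<bullet> Z \<omega>))"
    and "(\<integral>\<omega>. indicator A \<omega> * (W \<omega> \<bullet> Z \<omega>) \<partial>M) = 0"
proof -
  interpret sigma_finite_subalgebra M F by (rule sub)
  have [measurable]: "W \<in> borel_measurable M" by (rule measurable_from_subalg[OF subalg W])
  have [measurable]: "A \<in> sets M" using A subalg by (auto simp: subalgebra_def)
  note Z[measurable]
  let ?f = "\<lambda>b \<omega>. indicator A \<omega> * (W \<omega> \<bullet> b)"
  have sum_eq: "indicator A \<omega> * (W \<omega> \<bullet> Z \<omega>) = (\<Sum>b\<in>Basis. ?f b \<omega> * (Z \<omega> \<bullet> b))" for \<omega>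
    by (simp add: euclidean_inner[of "W \<omega>" "Z \<omega>"] sum_distrib_left mult.assoc)
  have int: "integrable M (\<lambda>\<omega>. ?f b \<omega> * (Z \<omega> \<bullet> b))" if b: "b \<in> Basis" for b
  proof (rule Bochner_Integration.integrable_bound[OF Bochner_Integration.integrable_add[OF W2 Z2]])
    show "AE \<omega> in M. norm (?f b \<omega> * (Z \<omega> \<bullet> b))
        \<le> norm (indicator A \<omega> * (norm (W \<omega>))\<^sup>2 + indicator A \<omega> * (norm (Z \<omega>))\<^sup>2)"
    proof (rule AE_I2)
      fix \<omega>
      have "\<bar>W \<omega> \<bullet> b\<bar> * \<bar>Z \<omega> \<bullet> b\<bar> \<le> norm (W \<omega>) * norm (Z \<omega>)"
        using b by (intro mult_mono) (auto simp: Basis_le_norm)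
      also have "\<dots> \<le> (norm (W \<omega>))\<^sup>2 + (norm (Z \<omega>))\<^sup>2"
        using sum_squares_bound[of "norm (W \<omega>)" "norm (Z \<omega>)"] mult_nonneg_nonneg[OF norm_ge_zero[of "W \<omega>"] norm_ge_zero[of "Z \<omega>"]]
        by linarith
      finally show "norm (?f b \<omega> * (Z \<omega> \<bullet> b))
          \<le> norm (indicator A \<omega> * (norm (W \<omega>))\<^sup>2 + indicator A \<omega> * (norm (Z \<omega>))\<^sup>2)"
        by (simp add: indicator_def abs_mult)
    qed
  qed measurable
  show "integrable M (\<lambda>\<omega>. indicator A \<omega> * (W \<omega> \<bullet> Z \<omega>))"
    unfolding sum_eq by (intro Bochner_Integration.integrable_sum int)
  have zero: "(\<integral>\<omega>. ?f b \<omega> * (Z \<omega> \<bullet> b) \<partial>M) = 0" if b: "b \<in> Basis" for b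
  proof -
    note W[measurable] A[measurable]
    have "?f b \<in> borel_measurable F" by measurable
    then have "(\<integral>\<omega>. ?f b \<omega> * (Z \<omega> \<bullet> b) \<partial>M)
        = (\<integral>\<omega>. ?f b \<omega> * real_cond_exp M F (\<lambda>\<omega>. Z \<omega> \<bullet> b) \<omega> \<partial>M)"
      using real_cond_exp_intg(2)[OF int[OF b]] by simp
    also have "\<dots> = (\<integral>\<omega>. 0 \<partial>M)"
    proof (rule integral_cong_AE)
      show "AE \<omega> in M. ?f b \<omega> * real_cond_exp M F (\<lambda>\<omega>. Z \<omega> \<bullet> b) \<omega> = 0"
        using mean
      proof (rule AE_mp, intro AE_I2 impI)
        fix \<omega> assume "vec_cond_exp M F Z \<omega> = 0"
        then have "(\<Sum>b\<in>Basis. real_cond_exp M F (\<lambda>\<omega>. Z \<omega> \<bullet> b) \<omega> *\<^sub>R b) \<bullet> b = 0"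
          by (simp add: vec_cond_exp_def)
        then show "?f b \<omega> * real_cond_exp M F (\<lambda>\<omega>. Z \<omega> \<bullet> b) \<omega> = 0"
          using b by (simp add: inner_sum_left_Basis)
      qed
    qed measurable
    finally show ?thesis by simp
  qed
  show "(\<integral>\<omega>. indicator A \<omega> * (W \<omega> \<bullet> Z \<omega>) \<partial>M) = 0"
    unfolding sum_eq by (subst Bochner_Integration.integral_sum) (auto simp: int zero)
qed

lemma noise_second_moment:
  fixes Z :: "'w \<Rightarrow> 'a::euclidean_space" and h :: "'w \<Rightarrow> real"
  assumes sub: "sigma_finite_subalgebra M F" and A: "A \<in> sets F"
    and Z: "Z \<in> borel_measurable M"
    and var: "AE \<omega> in M. nn_cond_exp M F (\<lambda>\<omega>. ennreal ((norm (Z \<omega>))\<^sup>2)) \<omega> \<le> ennreal (h \<omega>)"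
    and h0: "\<And>\<omega>. 0 \<le> h \<omega>" and h: "integrable M (\<lambda>\<omega>. indicator A \<omega> * h \<omega>)"
  shows "integrable M (\<lambda>\<omega>. indicator A \<omega> * (norm (Z \<omega>))\<^sup>2)"
    and "(\<integral>\<omega>. indicator A \<omega> * (norm (Z \<omega>))\<^sup>2 \<partial>M) \<le> (\<integral>\<omega>. indicator A \<omega> * h \<omega> \<partial>M)"
proof -
  interpret sigma_finite_subalgebra M F by (rule sub)
  have AM[measurable]: "A \<in> sets M" using A subalg by (auto simp: subalgebra_def)
  note Z[measurable]
  have "(\<integral>\<^sup>+\<omega>. ennreal (indicator A \<omega> * (norm (Z \<omega>))\<^sup>2) \<partial>M)
      = (\<integral>\<^sup>+\<omega>. indicator A \<omega> * ennreal ((norm (Z \<omega>))\<^sup>2) \<partial>M)"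
    by (intro nn_integral_cong) (simp add: indicator_def)
  also have "\<dots> = (\<integral>\<^sup>+\<omega>. indicator A \<omega> * nn_cond_exp M F (\<lambda>\<omega>. ennreal ((norm (Z \<omega>))\<^sup>2)) \<omega> \<partial>M)"
    by (rule nn_cond_exp_intg[symmetric]) (use A in \<open>measurable\<close>)
  also have "\<dots> \<le> (\<integral>\<^sup>+\<omega>. ennreal (indicator A \<omega> * h \<omega>) \<partial>M)"
    using var by (intro nn_integral_mono_AE) (auto simp: indicator_def elim!: eventually_mono)
  also have "\<dots> = ennreal (\<integral>\<omega>. indicator A \<omega> * h \<omega> \<partial>M)"
    by (rule nn_integral_eq_integral[OF h]) (simp add: h0)
  finally have le: "(\<integral>\<^sup>+\<omega>. ennreal (indicator A \<omega> * (norm (Z \<omega>))\<^sup>2) \<partial>M)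
      \<le> ennreal (\<integral>\<omega>. indicator A \<omega> * h \<omega> \<partial>M)" .
  show int: "integrable M (\<lambda>\<omega>. indicator A \<omega> * (norm (Z \<omega>))\<^sup>2)"
  proof (rule integrableI_nonneg)
    show "(\<integral>\<^sup>+\<omega>. ennreal (indicator A \<omega> * (norm (Z \<omega>))\<^sup>2) \<partial>M) < \<infinity>"
      using le by (rule le_less_trans) simp
  qed simp_all
  have "ennreal (\<integral>\<omega>. indicator A \<omega> * (norm (Z \<omega>))\<^sup>2 \<partial>M)
      \<le> ennreal (\<integral>\<omega>. indicator A \<omega> * h \<omega> \<partial>M)"
    using le by (subst nn_integral_eq_integral[OF int, symmetric]) auto
  then show "(\<integral>\<omega>. indicator A \<omega> * (norm (Z \<omega>))\<^sup>2 \<partial>M) \<le> (\<integral>\<omega>. indicator A \<omega> * h \<omega> \<partial>M)"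
    by (rule ennreal_le_iff[THEN iffD1, rotated]) (simp add: h0)
qed

text \<open>
  Used to obtain an inequality on an arbitrary event of the history from its restrictions to events
  on which the current iterate is bounded, where the integrals are finite.
\<close>

lemma nn_integral_le_by_truncation:
  fixes f g :: "'w \<Rightarrow> ennreal" and h :: "'w \<Rightarrow> real"
  assumes [measurable]: "f \<in> borel_measurable M" "h \<in> borel_measurable M"
    and le: "\<And>N :: nat. (\<integral>\<^sup>+\<omega>\<in>{\<omega> \<in> space M. h \<omega> \<le> real N}. f \<omega> \<partial>M) \<le> (\<integral>\<^sup>+\<omega>. g \<omega> \<partial>M)"
  shows "(\<integral>\<^sup>+\<omega>. f \<omega> \<partial>M) \<le> (\<integral>\<^sup>+\<omega>. g \<omega> \<partial>M)"
proof -
  let ?B = "\<lambda>N :: nat. {\<omega> \<in> space M. h \<omega> \<le> real N}"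
  have "(\<integral>\<^sup>+\<omega>. f \<omega> \<partial>M) = (\<integral>\<^sup>+\<omega>. (SUP N. f \<omega> * indicator (?B N) \<omega>) \<partial>M)"
  proof (rule nn_integral_cong)
    fix \<omega> assume w: "\<omega> \<in> space M"
    obtain N :: nat where N: "h \<omega> \<le> real N" using real_arch_simple by blast
    show "f \<omega> = (SUP N. f \<omega> * indicator (?B N) \<omega>)"
    proof (rule antisym)
      show "f \<omega> \<le> (SUP N. f \<omega> * indicator (?B N) \<omega>)"
        using w N by (intro SUP_upper2[of N]) simp_all
      show "(SUP N. f \<omega> * indicator (?B N) \<omega>) \<le> f \<omega>"
        by (intro SUP_least) (simp add: indicator_def)
    qed
  qed
  also have "\<dots> = (SUP N. \<integral>\<^sup>+\<omega>\<in>?B N. f \<omega> \<partial>M)"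
  proof (rule nn_integral_monotone_convergence_SUP)
    show "incseq (\<lambda>N \<omega>. f \<omega> * indicator (?B N) \<omega>)"
      by (intro incseq_SucI le_funI) (auto simp: indicator_def)
  qed measurable
  also have "\<dots> \<le> (\<integral>\<^sup>+\<omega>. g \<omega> \<partial>M)" by (rule SUP_least) (rule le)
  finally show ?thesis .
qed

text \<open>
  The conditional form of the energy estimate.  On an event \<open>B\<close> of \<open>F\<close> on which \<open>x\<close> is bounded,
  everything is square integrable, so the two linear noise terms integrate to \<open>0\<close>: the first noise
  is centred given \<open>F\<close>, the second given \<open>G\<close>.  The variance bounds turn the quadratic noise terms
  into multiples of \<open>1 + (norm (x - p))\<^sup>2\<close>; for the second noise this uses that \<open>norm (y - p)\<close>
  is itself bounded by \<open>norm (x - p)\<close> and \<open>\<gamma> * norm z\<close>, with \<open>\<gamma> \<kappa> \<le> 1/3\<close>.  The coefficient \<open>e\<close>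
  has order \<open>\<gamma>\<^sup>2 \<eta> + \<eta>\<^sup>2\<close> and is thus summable along the iteration.
\<close>

lemma dseg_one_step:
  fixes V :: "'a::euclidean_space \<Rightarrow> 'a" and x y x' z z' :: "'w \<Rightarrow> 'a"
  assumes fm: "finite_measure M" and MG: "subalgebra M G" and GF: "subalgebra G F"
    and xF: "x \<in> borel_measurable F" and yG: "y \<in> borel_measurable G"
    and z: "z \<in> borel_measurable M" and z': "z' \<in> borel_measurable M"
    and y: "\<And>\<omega>. \<omega> \<in> space M \<Longrightarrow> y \<omega> = x \<omega> - \<gamma> *\<^sub>R (V (x \<omega>) + z \<omega>)"
    and x': "\<And>\<omega>. \<omega> \<in> space M \<Longrightarrow> x' \<omega> = x \<omega> - \<eta> *\<^sub>R (V (y \<omega>) + z' \<omega>)"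
    and lip: "L-lipschitz_on UNIV V"
    and p: "V p = 0" "\<And>x. V x \<bullet> (x - p) \<ge> 0"
    and step: "0 < \<eta>" "\<eta> \<le> \<gamma>" "\<gamma> * L \<le> 1 / 3" "\<gamma> * \<kappa> \<le> 1 / 3"
    and \<kappa>: "0 \<le> \<kappa>"
    and mean: "AE \<omega> in M. vec_cond_exp M F z \<omega> = 0" "AE \<omega> in M. vec_cond_exp M G z' \<omega> = 0"
    and var: "AE \<omega> in M. nn_cond_exp M F (\<lambda>\<omega>. ennreal ((norm (z \<omega>))\<^sup>2)) \<omega>
        \<le> ennreal ((\<sigma> + \<kappa> * norm (x \<omega> - p))\<^sup>2)"
      "AE \<omega> in M. nn_cond_exp M G (\<lambda>\<omega>. ennreal ((norm (z' \<omega>))\<^sup>2)) \<omega>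
        \<le> ennreal ((\<sigma> + \<kappa> * norm (y \<omega> - p))\<^sup>2)"
    and e: "e = (6 * L * \<gamma>\<^sup>2 * \<eta> + 9 * \<eta>\<^sup>2) * (\<sigma>\<^sup>2 + \<kappa>\<^sup>2)"
    and A: "A \<in> sets F"
  shows "(\<integral>\<^sup>+\<omega>\<in>A. ennreal ((norm (x' \<omega> - p))\<^sup>2 + \<gamma> * \<eta> / 2 * (norm (V (x \<omega>)))\<^sup>2) \<partial>M)
    \<le> (\<integral>\<^sup>+\<omega>\<in>A. ennreal ((1 + e) * (norm (x \<omega> - p))\<^sup>2 + e) \<partial>M)"
proof -
  interpret finite_measure M by (rule fm)
  have MF: "subalgebra M F" using MG GF by (auto simp: subalgebra_def)
  have sF: "sigma_finite_subalgebra M F" and sG: "sigma_finite_subalgebra M G"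
    using fm MF MG
    by (auto intro!: finite_measure_subalgebra_is_sigma_finite
        simp: finite_measure_subalgebra_def finite_measure_subalgebra_axioms_def)
  have L0: "0 \<le> L" by (rule lipschitz_on_nonneg[OF lip])
  have g0: "0 < \<gamma>" using step by linarith
  have Lip: "norm (V u) \<le> L * norm (u - p)" for u
    using lipschitz_onD[OF lip, of u p] p(1) by (simp add: dist_norm)
  have V[measurable]: "V \<in> borel_measurable borel"
    by (rule borel_measurable_continuous_onI) (rule lipschitz_on_continuous_on[OF lip])
  have xG: "x \<in> borel_measurable G" by (rule measurable_from_subalg[OF GF xF])
  have [measurable]: "x \<in> borel_measurable M" "y \<in> borel_measurable M"
    using measurable_from_subalg[OF MF xF] measurable_from_subalg[OF MG yG] by auto
  note z[measurable] z'[measurable]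
  have [measurable]: "x' \<in> borel_measurable M"
  proof -
    have "(\<lambda>\<omega>. x \<omega> - \<eta> *\<^sub>R (V (y \<omega>) + z' \<omega>)) \<in> borel_measurable M" by measurable
    then show ?thesis using x' by (subst measurable_cong) auto
  qed
  have AM[measurable]: "A \<in> sets M" using A MF by (auto simp: subalgebra_def)
  define d where "d \<omega> = norm (x \<omega> - p)" for \<omega>
  have [measurable]: "d \<in> borel_measurable M" unfolding d_def by measurable
  have e0: "0 \<le> e" unfolding e using L0 step by simp
  let ?f = "\<lambda>\<omega>. (norm (x' \<omega> - p))\<^sup>2 + \<gamma> * \<eta> / 2 * (norm (V (x \<omega>)))\<^sup>2"
  let ?g = "\<lambda>\<omega>. (1 + e) * (d \<omega>)\<^sup>2 + e"
  have fg0: "0 \<le> ?f \<omega>" "0 \<le> ?g \<omega>" for \<omega> using step g0 e0 by simp_all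
  have "(\<integral>\<^sup>+\<omega>\<in>A. ennreal (?f \<omega>) \<partial>M) \<le> (\<integral>\<^sup>+\<omega>\<in>A. ennreal (?g \<omega>) \<partial>M)"
  proof (rule nn_integral_le_by_truncation[where h = d])
    fix N :: nat
    define B where "B = {\<omega> \<in> A. d \<omega> \<le> real N}"
    have BF: "B \<in> sets F"
    proof -
      note xF[measurable] A[measurable]
      have "{\<omega> \<in> space F. \<omega> \<in> A \<and> norm (x \<omega> - p) \<le> real N} \<in> sets F" by measurable
      also have "{\<omega> \<in> space F. \<omega> \<in> A \<and> norm (x \<omega> - p) \<le> real N} = B"
        using sets.sets_into_space[OF A] by (auto simp: B_def d_def)
      finally show ?thesis .
    qed
    then have BG: "B \<in> sets G" and BM[measurable]: "B \<in> sets M"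
      using GF MF by (auto simp: subalgebra_def)
    have B_space: "\<omega> \<in> space M" if "\<omega> \<in> B" for \<omega> using that sets.sets_into_space[OF BM] by auto
    let ?I = "\<lambda>h \<omega>. indicator B \<omega> * h \<omega> :: real"
    have dom: "integrable M (?I h)"
      if "integrable M (?I k)" "h \<in> borel_measurable M" "\<And>\<omega>. \<omega> \<in> B \<Longrightarrow> \<bar>h \<omega>\<bar> \<le> k \<omega>" for h k
    proof (rule Bochner_Integration.integrable_bound[OF that(1)])
      show "?I h \<in> borel_measurable M" using that(2) by measurable
      show "AE \<omega> in M. norm (?I h \<omega>) \<le> norm (?I k \<omega>)"
        using that(3) by (intro AE_I2) (force simp: indicator_def)
    qed
    have lin: "integrable M (?I (\<lambda>\<omega>. \<alpha> * h \<omega> + \<beta> * k \<omega>))"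
      "(\<integral>\<omega>. ?I (\<lambda>\<omega>. \<alpha> * h \<omega> + \<beta> * k \<omega>) \<omega> \<partial>M) = \<alpha> * (\<integral>\<omega>. ?I h \<omega> \<partial>M) + \<beta> * (\<integral>\<omega>. ?I k \<omega> \<partial>M)"
      if h: "integrable M (?I h)" and k: "integrable M (?I k)" for h k \<alpha> \<beta>
    proof -
      have eq: "?I (\<lambda>\<omega>. \<alpha> * h \<omega> + \<beta> * k \<omega>) = (\<lambda>\<omega>. \<alpha> * ?I h \<omega> + \<beta> * ?I k \<omega>)"
        by (auto simp: indicator_def)
      show "integrable M (?I (\<lambda>\<omega>. \<alpha> * h \<omega> + \<beta> * k \<omega>))" unfolding eq using h k by simp
      show "(\<integral>\<omega>. ?I (\<lambda>\<omega>. \<alpha> * h \<omega> + \<beta> * k \<omega>) \<omega> \<partial>M) = \<alpha> * (\<integral>\<omega>. ?I h \<omega> \<partial>M) + \<beta> * (\<integral>\<omega>. ?I k \<omega> \<partial>M)"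
        unfolding eq using h k by simp
    qed
    have const: "integrable M (?I (\<lambda>\<omega>. c))" for c
      by (intro integrable_mult_left) (simp add: less_top[symmetric])
    have int_d: "integrable M (?I (\<lambda>\<omega>. (d \<omega>)\<^sup>2))"
      by (rule dom[OF const[of "(real N)\<^sup>2"]]) (auto simp: B_def d_def intro: power_mono)
    have int_noise_bound: "integrable M (?I (\<lambda>\<omega>. (\<sigma> + \<kappa> * h \<omega>)\<^sup>2))"
      "(\<integral>\<omega>. ?I (\<lambda>\<omega>. (\<sigma> + \<kappa> * h \<omega>)\<^sup>2) \<omega> \<partial>M)
        \<le> 2 * \<sigma>\<^sup>2 * (\<integral>\<omega>. ?I (\<lambda>\<omega>. 1) \<omega> \<partial>M) + 2 * \<kappa>\<^sup>2 * (\<integral>\<omega>. ?I (\<lambda>\<omega>. (h \<omega>)\<^sup>2) \<omega> \<partial>M)"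
      if h[measurable]: "h \<in> borel_measurable M" and int: "integrable M (?I (\<lambda>\<omega>. (h \<omega>)\<^sup>2))" for h
    proof -
      have pw: "(\<sigma> + \<kappa> * h \<omega>)\<^sup>2 \<le> 2 * \<sigma>\<^sup>2 * 1 + 2 * \<kappa>\<^sup>2 * (h \<omega>)\<^sup>2" for \<omega>
        using norm_add_power2_le[of \<sigma> "\<kappa> * h \<omega>"] by (simp add: power_mult_distrib)
      have bound: "integrable M (?I (\<lambda>\<omega>. 2 * \<sigma>\<^sup>2 * 1 + 2 * \<kappa>\<^sup>2 * (h \<omega>)\<^sup>2))"
        by (rule lin(1)[OF const int])
      show int': "integrable M (?I (\<lambda>\<omega>. (\<sigma> + \<kappa> * h \<omega>)\<^sup>2))"
        by (rule dom[OF bound]) (use pw in auto)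
      have "(\<integral>\<omega>. ?I (\<lambda>\<omega>. (\<sigma> + \<kappa> * h \<omega>)\<^sup>2) \<omega> \<partial>M)
          \<le> (\<integral>\<omega>. ?I (\<lambda>\<omega>. 2 * \<sigma>\<^sup>2 * 1 + 2 * \<kappa>\<^sup>2 * (h \<omega>)\<^sup>2) \<omega> \<partial>M)"
        using pw by (intro integral_mono int' bound mult_left_mono) auto
      then show "(\<integral>\<omega>. ?I (\<lambda>\<omega>. (\<sigma> + \<kappa> * h \<omega>)\<^sup>2) \<omega> \<partial>M)
        \<le> 2 * \<sigma>\<^sup>2 * (\<integral>\<omega>. ?I (\<lambda>\<omega>. 1) \<omega> \<partial>M) + 2 * \<kappa>\<^sup>2 * (\<integral>\<omega>. ?I (\<lambda>\<omega>. (h \<omega>)\<^sup>2) \<omega> \<partial>M)"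
        unfolding lin(2)[OF const int] .
    qed
    define P q u u' where "P = (\<integral>\<omega>. ?I (\<lambda>\<omega>. 1) \<omega> \<partial>M)" and "q = (\<integral>\<omega>. ?I (\<lambda>\<omega>. (d \<omega>)\<^sup>2) \<omega> \<partial>M)"
      and "u = (\<integral>\<omega>. ?I (\<lambda>\<omega>. (norm (z \<omega>))\<^sup>2) \<omega> \<partial>M)"
      and "u' = (\<integral>\<omega>. ?I (\<lambda>\<omega>. (norm (z' \<omega>))\<^sup>2) \<omega> \<partial>M)"
    have P0: "0 \<le> P" "0 \<le> q" unfolding P_def q_def by (intro integral_nonneg_AE; simp)+
    note nb = int_noise_bound[OF _ int_d]
    have int_z: "integrable M (?I (\<lambda>\<omega>. (norm (z \<omega>))\<^sup>2))"
      by (rule noise_second_moment(1)[OF sF BF z var(1)]) (use nb(1) in \<open>simp_all add: d_def[abs_def]\<close>)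
    have u: "u \<le> 2 * \<sigma>\<^sup>2 * P + 2 * \<kappa>\<^sup>2 * q"
    proof -
      have "u \<le> (\<integral>\<omega>. ?I (\<lambda>\<omega>. (\<sigma> + \<kappa> * d \<omega>)\<^sup>2) \<omega> \<partial>M)"
        unfolding u_def d_def
        by (rule noise_second_moment(2)[OF sF BF z var(1)]) (use nb(1) in \<open>simp_all add: d_def[abs_def]\<close>)
      also note nb(2)
      finally show ?thesis by (simp add: P_def q_def)
    qed
    \<comment> \<open>the noiseless half step expands distances to \<open>p\<close> by at most \<open>1 + \<gamma> L \<le> 4/3\<close>\<close>
    have tilde: "norm (x \<omega> - \<gamma> *\<^sub>R V (x \<omega>) - p) \<le> 4 / 3 * d \<omega>" for \<omega>
    proof -
      have "norm (x \<omega> - \<gamma> *\<^sub>R V (x \<omega>) - p) \<le> d \<omega> + \<gamma> * norm (V (x \<omega>))"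
        using norm_triangle_ineq4[of "x \<omega> - p" "\<gamma> *\<^sub>R V (x \<omega>)"] g0
        by (simp add: d_def algebra_simps)
      also have "\<dots> \<le> d \<omega> + \<gamma> * (L * d \<omega>)"
        using Lip[of "x \<omega>"] g0 by (simp add: d_def)
      also have "\<gamma> * (L * d \<omega>) \<le> 1 / 3 * d \<omega>"
        using mult_right_mono[OF step(3), of "d \<omega>"] by (simp add: d_def mult.assoc)
      finally show ?thesis by simp
    qed
    have y_dist: "(norm (y \<omega> - p))\<^sup>2 \<le> 4 * (d \<omega>)\<^sup>2 + 2 * \<gamma>\<^sup>2 * (norm (z \<omega>))\<^sup>2"
      if w: "\<omega> \<in> space M" for \<omega>
    proof -
      have eq: "y \<omega> - p = (x \<omega> - \<gamma> *\<^sub>R V (x \<omega>) - p) - \<gamma> *\<^sub>R z \<omega>"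
        by (simp add: y[OF w] algebra_simps)
      have "(norm (y \<omega> - p))\<^sup>2
          \<le> 2 * (norm (x \<omega> - \<gamma> *\<^sub>R V (x \<omega>) - p))\<^sup>2 + 2 * (\<gamma> * norm (z \<omega>))\<^sup>2"
        using norm_diff_power2_le[of "x \<omega> - \<gamma> *\<^sub>R V (x \<omega>) - p" "\<gamma> *\<^sub>R z \<omega>"] g0 unfolding eq by simp
      moreover have "(norm (x \<omega> - \<gamma> *\<^sub>R V (x \<omega>) - p))\<^sup>2 \<le> (4 / 3 * d \<omega>)\<^sup>2"
        using tilde by (intro power_mono) auto
      ultimately show ?thesis by (simp add: power_mult_distrib power2_eq_square[of "4 :: real"]
            power2_eq_square[of "3 :: real"] power_divide) (use zero_le_power2[of "d \<omega>"] in linarith)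
    qed
    have int_yb: "integrable M (?I (\<lambda>\<omega>. 4 * (d \<omega>)\<^sup>2 + 2 * \<gamma>\<^sup>2 * (norm (z \<omega>))\<^sup>2))"
      by (rule lin(1)[OF int_d int_z])
    have int_y: "integrable M (?I (\<lambda>\<omega>. (norm (y \<omega> - p))\<^sup>2))"
      by (rule dom[OF int_yb]) (use y_dist B_space in auto)
    have y_int: "(\<integral>\<omega>. ?I (\<lambda>\<omega>. (norm (y \<omega> - p))\<^sup>2) \<omega> \<partial>M) \<le> 4 * q + 2 * \<gamma>\<^sup>2 * u"
    proof -
      have "(\<integral>\<omega>. ?I (\<lambda>\<omega>. (norm (y \<omega> - p))\<^sup>2) \<omega> \<partial>M)
          \<le> (\<integral>\<omega>. ?I (\<lambda>\<omega>. 4 * (d \<omega>)\<^sup>2 + 2 * \<gamma>\<^sup>2 * (norm (z \<omega>))\<^sup>2) \<omega> \<partial>M)"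
        using y_dist by (intro integral_mono int_y int_yb mult_left_mono) auto
      then show ?thesis unfolding lin(2)[OF int_d int_z] q_def u_def .
    qed
    note nb' = int_noise_bound[OF _ int_y]
    have int_z': "integrable M (?I (\<lambda>\<omega>. (norm (z' \<omega>))\<^sup>2))"
      by (rule noise_second_moment(1)[OF sG BG z' var(2)]) (use nb'(1) in simp_all)
    have u': "u' \<le> 3 * \<sigma>\<^sup>2 * P + 9 * \<kappa>\<^sup>2 * q"
    proof -
      have "u' \<le> (\<integral>\<omega>. ?I (\<lambda>\<omega>. (\<sigma> + \<kappa> * norm (y \<omega> - p))\<^sup>2) \<omega> \<partial>M)"
        unfolding u'_def
        by (rule noise_second_moment(2)[OF sG BG z' var(2)]) (use nb'(1) in simp_all)
      also have "\<dots> \<le> 2 * \<sigma>\<^sup>2 * P + 2 * \<kappa>\<^sup>2 * (\<integral>\<omega>. ?I (\<lambda>\<omega>. (norm (y \<omega> - p))\<^sup>2) \<omega> \<partial>M)"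
        unfolding P_def by (rule nb'(2)) measurable
      also have "\<dots> \<le> 2 * \<sigma>\<^sup>2 * P + 2 * \<kappa>\<^sup>2 * (4 * q + 2 * \<gamma>\<^sup>2 * u)"
        by (intro add_left_mono mult_left_mono y_int) simp
      also have "\<dots> = 2 * \<sigma>\<^sup>2 * P + 8 * \<kappa>\<^sup>2 * q + 4 * ((\<gamma> * \<kappa>)\<^sup>2 * u)"
        by (simp add: algebra_simps power_mult_distrib)
      also have "(\<gamma> * \<kappa>)\<^sup>2 * u \<le> 1 / 9 * (2 * \<sigma>\<^sup>2 * P + 2 * \<kappa>\<^sup>2 * q)"
      proof (rule mult_mono)
        show "(\<gamma> * \<kappa>)\<^sup>2 \<le> 1 / 9"
          using power_mono[OF step(4), of 2] g0 \<kappa> by (simp add: power2_eq_square)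
        show "0 \<le> u" unfolding u_def by (intro integral_nonneg_AE) simp
      qed (use u in auto)
      finally have le: "u' \<le> 2 * \<sigma>\<^sup>2 * P + 8 * \<kappa>\<^sup>2 * q + 4 * (1 / 9 * (2 * \<sigma>\<^sup>2 * P + 2 * \<kappa>\<^sup>2 * q))"
        by simp
      have "0 \<le> \<sigma>\<^sup>2 * P" "0 \<le> \<kappa>\<^sup>2 * q" using P0 by simp_all
      with le show ?thesis unfolding mult.assoc distrib_left by linarith
    qed
    define W W' where "W \<omega> = V (x \<omega> - \<gamma> *\<^sub>R V (x \<omega>))" and "W' \<omega> = x \<omega> - p - \<eta> *\<^sub>R V (y \<omega>)" for \<omega>
    have WF: "W \<in> borel_measurable F"
    proof -
      note xF[measurable]
      show ?thesis unfolding W_def by measurable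
    qed
    have WG: "W' \<in> borel_measurable G"
    proof -
      note xG[measurable] yG[measurable]
      show ?thesis unfolding W'_def by measurable
    qed
    have WM: "W \<in> borel_measurable M" "W' \<in> borel_measurable M"
      using measurable_from_subalg[OF MF WF] measurable_from_subalg[OF MG WG] by auto
    have int_W: "integrable M (?I (\<lambda>\<omega>. (norm (W \<omega>))\<^sup>2))"
    proof (rule dom[OF const[of "(L * (4 / 3 * real N))\<^sup>2"]])
      fix \<omega> assume "\<omega> \<in> B"
      then have "norm (x \<omega> - \<gamma> *\<^sub>R V (x \<omega>) - p) \<le> 4 / 3 * real N"
        using tilde[of \<omega>] by (simp add: B_def)
      then have "norm (W \<omega>) \<le> L * (4 / 3 * real N)"
        using Lip[of "x \<omega> - \<gamma> *\<^sub>R V (x \<omega>)"] L0 unfolding W_def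
        by (meson mult_left_mono order_trans)
      then show "\<bar>(norm (W \<omega>))\<^sup>2\<bar> \<le> (L * (4 / 3 * real N))\<^sup>2" by (simp add: power_mono)
    qed (use WM in simp)
    have int_W': "integrable M (?I (\<lambda>\<omega>. (norm (W' \<omega>))\<^sup>2))"
    proof (rule dom[OF lin(1)[OF int_d int_y, of 2 "2 * (\<eta> * L)\<^sup>2"]])
      fix \<omega> assume "\<omega> \<in> B"
      have "(norm (W' \<omega>))\<^sup>2 \<le> 2 * (d \<omega>)\<^sup>2 + 2 * (norm (\<eta> *\<^sub>R V (y \<omega>)))\<^sup>2"
        unfolding W'_def d_def by (rule norm_diff_power2_le)
      also have "(norm (\<eta> *\<^sub>R V (y \<omega>)))\<^sup>2 \<le> (\<eta> * L * norm (y \<omega> - p))\<^sup>2"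
        using Lip[of "y \<omega>"] step by (intro power_mono) (simp_all add: mult.assoc)
      finally show "\<bar>(norm (W' \<omega>))\<^sup>2\<bar> \<le> 2 * (d \<omega>)\<^sup>2 + 2 * (\<eta> * L)\<^sup>2 * (norm (y \<omega> - p))\<^sup>2"
        by (simp add: power_mult_distrib mult.assoc)
    qed (use WM in simp)
    note orth = noise_orthogonal[OF sF BF WF z mean(1) int_W int_z]
    note orth' = noise_orthogonal[OF sG BG WG z' mean(2) int_W' int_z']
    let ?c = "3 * L * \<gamma>\<^sup>2 * \<eta>"
    \<comment> \<open>the right-hand side of the pathwise estimate, parsed as nested combinations of two terms so that \<open>lin\<close> applies\<close>
    let ?r = "\<lambda>\<omega>. 1 * (1 * (1 * (d \<omega>)\<^sup>2 + - (2 * \<gamma> * \<eta>) * (W \<omega> \<bullet> z \<omega>)) + - (2 * \<eta>) * (W' \<omega> \<bullet> z' \<omega>))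
      + 1 * (?c * (norm (z \<omega>))\<^sup>2 + \<eta>\<^sup>2 * (norm (z' \<omega>))\<^sup>2)"
    have fr: "?f \<omega> \<le> ?r \<omega>" if w: "\<omega> \<in> space M" for \<omega>
      using dseg_descent[OF lip p step(1-3) y[OF w] x'[OF w]] unfolding W_def W'_def d_def by simp
    note l1 = lin[OF int_d orth(1)]
    note l2 = lin[OF l1(1) orth'(1)]
    note l3 = lin[OF int_z int_z']
    note l4 = lin[OF l2(1) l3(1)]
    have int_r: "integrable M (?I ?r)" by (rule l4)
    have r: "(\<integral>\<omega>. ?I ?r \<omega> \<partial>M) = q + ?c * u + \<eta>\<^sup>2 * u'"
      unfolding l4(2) l3(2) l2(2) l1(2) orth(2) orth'(2) by (simp add: q_def u_def u'_def)
    have int_g: "integrable M (?I (\<lambda>\<omega>. (1 + e) * (d \<omega>)\<^sup>2 + e * 1))"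
      by (rule lin(1)[OF int_d const])
    have g: "(\<integral>\<omega>. ?I (\<lambda>\<omega>. (1 + e) * (d \<omega>)\<^sup>2 + e * 1) \<omega> \<partial>M) = (1 + e) * q + e * P"
      unfolding lin(2)[OF int_d const] q_def P_def ..
    have rg: "q + ?c * u + \<eta>\<^sup>2 * u' \<le> (1 + e) * q + e * P"
    proof -
      have "?c * u \<le> ?c * (2 * \<sigma>\<^sup>2 * P + 2 * \<kappa>\<^sup>2 * q)"
        using L0 step by (intro mult_left_mono u) simp
      moreover have "\<eta>\<^sup>2 * u' \<le> \<eta>\<^sup>2 * (3 * \<sigma>\<^sup>2 * P + 9 * \<kappa>\<^sup>2 * q)"
        by (intro mult_left_mono u') simp
      moreover have "\<eta>\<^sup>2 * (3 * \<sigma>\<^sup>2 * P + 9 * \<kappa>\<^sup>2 * q) \<le> \<eta>\<^sup>2 * (9 * \<sigma>\<^sup>2 * P + 9 * \<kappa>\<^sup>2 * q)"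
        using P0 by (intro mult_left_mono add_right_mono mult_right_mono) auto
      ultimately have "?c * u + \<eta>\<^sup>2 * u' \<le> (2 * ?c + 9 * \<eta>\<^sup>2) * (\<sigma>\<^sup>2 * P + \<kappa>\<^sup>2 * q)"
        by (simp add: algebra_simps)
      also have "\<dots> \<le> (2 * ?c + 9 * \<eta>\<^sup>2) * ((\<sigma>\<^sup>2 + \<kappa>\<^sup>2) * (P + q))"
        using P0 L0 step by (intro mult_left_mono) (auto simp: algebra_simps)
      also have "\<dots> = e * q + e * P" by (simp add: e algebra_simps)
      finally show ?thesis by (simp add: algebra_simps)
    qed
    have "(\<integral>\<^sup>+\<omega>. (ennreal (?f \<omega>) * indicator A \<omega>) * indicator {\<omega> \<in> space M. d \<omega> \<le> real N} \<omega> \<partial>M)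
        \<le> (\<integral>\<^sup>+\<omega>. ennreal (?I ?r \<omega>) \<partial>M)"
      using fr by (intro nn_integral_mono) (auto simp: indicator_def B_def intro!: ennreal_leI)
    also have "\<dots> = ennreal (q + ?c * u + \<eta>\<^sup>2 * u')"
    proof -
      have "0 \<le> ?I ?r \<omega>" if "\<omega> \<in> space M" for \<omega>
        using order_trans[OF fg0(1) fr[OF that]] by (simp add: indicator_def)
      then show ?thesis
        unfolding r[symmetric] by (intro nn_integral_eq_integral int_r AE_I2)
    qed
    also have "\<dots> \<le> ennreal ((1 + e) * q + e * P)" by (rule ennreal_leI) (rule rg)
    also have "\<dots> = (\<integral>\<^sup>+\<omega>. ennreal (?I (\<lambda>\<omega>. (1 + e) * (d \<omega>)\<^sup>2 + e * 1) \<omega>) \<partial>M)"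
      unfolding g[symmetric] using e0 by (intro nn_integral_eq_integral[symmetric] int_g AE_I2) simp
    also have "\<dots> \<le> (\<integral>\<^sup>+\<omega>\<in>A. ennreal (?g \<omega>) \<partial>M)"
      by (intro nn_integral_mono) (auto simp: indicator_def B_def)
    finally show "(\<integral>\<^sup>+\<omega>\<in>{\<omega> \<in> space M. d \<omega> \<le> real N}. (ennreal (?f \<omega>) * indicator A \<omega>) \<partial>M)
        \<le> (\<integral>\<^sup>+\<omega>\<in>A. ennreal (?g \<omega>) \<partial>M)" .
  qed measurable
  then show ?thesis by (simp only: d_def)
qed

section \<open>Histories and almost sure convergence\<close>

lemma sets_history:
  "sets (history M X k)
    = sigma_sets (space M) {X s -` A \<inter> space M | s A. s \<in> {2..k} \<and> A \<in> sets borel}"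
  unfolding history_def by (rule sets_measure_of) auto

lemma space_history [simp]: "space (history M X k) = space M"
  unfolding history_def by (rule space_measure_of) auto

lemma history_subalgebra:
  assumes "\<And>k. 2 \<le> k \<Longrightarrow> X k \<in> borel_measurable M"
  shows "subalgebra M (history M X k)"
  unfolding subalgebra_def sets_history
proof (intro conjI sets.sigma_sets_subset)
  show "{X s -` A \<inter> space M | s A. s \<in> {2..k} \<and> A \<in> sets borel} \<subseteq> sets M"
    using assms measurable_sets by fastforce
qed simp

lemma history_mono:
  assumes "j \<le> k"
  shows "subalgebra (history M X k) (history M X j)"
  unfolding subalgebra_def sets_history
proof (intro conjI sigma_sets_mono')
  show "{X s -` A \<inter> space M | s A. s \<in> {2..j} \<and> A \<in> sets borel}
      \<subseteq> {X s -` A \<inter> space M | s A. s \<in> {2..k} \<and> A \<in> sets borel}"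
    using order_trans[OF _ assms] by fastforce
qed simp

lemma measurable_history:
  fixes X :: "nat \<Rightarrow> 'w \<Rightarrow> 'a::euclidean_space"
  assumes "2 \<le> j" "j \<le> k"
  shows "X j \<in> borel_measurable (history M X k)"
proof (rule measurableI)
  fix A :: "'a set" assume "A \<in> sets borel"
  then have "X j -` A \<inter> space M \<in> {X s -` A \<inter> space M | s A. s \<in> {2..k} \<and> A \<in> sets borel}"
    using assms by auto
  then show "X j -` A \<inter> space (history M X k) \<in> sets (history M X k)"
    unfolding sets_history by (simp add: sigma_sets.Basic)
qed simp

theorem theorem1:
  fixes M :: "'w measure"
    and V :: "'a::euclidean_space \<Rightarrow> 'a"
    and X Z :: "nat \<Rightarrow> 'w \<Rightarrow> 'a"
    and \<gamma> \<eta> :: "nat \<Rightarrow> real"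
    and L \<sigma> \<kappa> :: real
  assumes "prob_space M"
    and "{x. V x = 0} \<noteq> {}"
    and "dseg M V \<gamma> \<eta> Z X"
    and "\<And>t. t \<ge> 1 \<Longrightarrow> \<gamma> t \<ge> \<eta> t \<and> \<eta> t > 0"
    and "L-lipschitz_on UNIV V"
    and "\<sigma> \<ge> 0" and "\<kappa> \<ge> 0"
    and "oracle_noise M {x. V x = 0} \<sigma> \<kappa> Z X"
    and "\<And>x x'. V x' = 0 \<Longrightarrow> V x \<bullet> (x - x') \<ge> 0"
    and "filterlim (\<lambda>T. \<Sum>t=1..T. \<gamma> t * \<eta> t) at_top sequentially"
    and "summable (\<lambda>t. (\<eta> t)\<^sup>2)"
    and "summable (\<lambda>t. (\<gamma> t)\<^sup>2 * \<eta> t)"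
    and "(SUP t\<in>{1..}. ereal (\<gamma> t)) < 1 / ereal (3 * max L \<kappa>)"
      \<comment> \<open>the right-hand side is \<open>\<infinity>\<close> if \<open>L = \<kappa> = 0\<close>\<close>
  shows "\<exists>Xlim \<in> borel_measurable M. AE \<omega> in M.
           V (Xlim \<omega>) = 0 \<and> (\<lambda>t. X (2 * t) \<omega>) \<longlonglongrightarrow> Xlim \<omega>"
proof -
  interpret prob_space M by (rule assms(1))
  have fm: "finite_measure M" by unfold_locales
  have L0: "0 \<le> L" by (rule lipschitz_on_nonneg[OF assms(5)])
  have contV: "continuous_on UNIV V" by (rule lipschitz_on_continuous_on[OF assms(5)])
  have V[measurable]: "V \<in> borel_measurable borel"
    by (rule borel_measurable_continuous_onI) (rule contV)
  have Zm[measurable]: "Z k \<in> borel_measurable M" if "2 \<le> k" for k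
    using assms(3) that by (simp add: dseg_def)
  have half: "X (2 * t + 1) \<omega> = X (2 * t) \<omega> - \<gamma> t *\<^sub>R (V (X (2 * t) \<omega>) + Z (2 * t) \<omega>)"
    and full: "X (2 * t + 2) \<omega> = X (2 * t) \<omega> - \<eta> t *\<^sub>R (V (X (2 * t + 1) \<omega>) + Z (2 * t + 1) \<omega>)"
    if "1 \<le> t" "\<omega> \<in> space M" for t \<omega>
    using assms(3) that by (simp_all add: dseg_def oracle_feedback_def)
  have Xm2: "X (2 * t) \<in> borel_measurable M \<and> X (2 * t + 1) \<in> borel_measurable M" if "1 \<le> t" for t
    using that
  proof (induction t rule: dec_induct)
    have half_m: "X (2 * t + 1) \<in> borel_measurable M"
      if t: "1 \<le> t" and [measurable]: "X (2 * t) \<in> borel_measurable M" for t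
    proof -
      have [measurable]: "Z (2 * t) \<in> borel_measurable M" by (rule Zm) (use t in simp)
      have "(\<lambda>\<omega>. X (2 * t) \<omega> - \<gamma> t *\<^sub>R (V (X (2 * t) \<omega>) + Z (2 * t) \<omega>)) \<in> borel_measurable M"
        by measurable
      then show ?thesis using half[OF t] by (subst measurable_cong) auto
    qed
    {
      case base
      have "X (2 * 1) \<in> borel_measurable M" using assms(3) by (simp add: dseg_def)
      with half_m[of 1] show ?case by simp
    next
      case (step t)
      note [measurable] = step.IH[THEN conjunct1] step.IH[THEN conjunct2]
      have [measurable]: "Z (2 * t + 1) \<in> borel_measurable M" by (rule Zm) (use step in simp)
      have "(\<lambda>\<omega>. X (2 * t) \<omega> - \<eta> t *\<^sub>R (V (X (2 * t + 1) \<omega>) + Z (2 * t + 1) \<omega>)) \<in> borel_measurable M"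
        by measurable
      then have "X (2 * t + 2) \<in> borel_measurable M"
        using full[OF step(1)] by (subst measurable_cong) auto
      then have "X (2 * Suc t) \<in> borel_measurable M" by simp
      with half_m[of "Suc t"] show ?case by simp
    }
  qed
  have Xm: "X k \<in> borel_measurable M" if k: "2 \<le> k" for k
  proof (cases "even k")
    case True
    then show ?thesis using Xm2[of "k div 2"] k by auto
  next
    case False
    then show ?thesis using Xm2[of "k div 2"] k by (auto simp: odd_two_times_div_two_succ)
  qed
  have small: "\<gamma> t * L \<le> 1 / 3" "\<gamma> t * \<kappa> \<le> 1 / 3" if t: "1 \<le> t" for t
  proof -
    have g0: "0 < \<gamma> t" using assms(4)[OF t] by linarith
    have "ereal (\<gamma> t) \<le> (SUP t\<in>{1..}. ereal (\<gamma> t))" using t by (intro SUP_upper) simp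
    then have lt: "ereal (\<gamma> t) < 1 / ereal (3 * max L \<kappa>)" using assms(13) by (rule le_less_trans)
    have "\<gamma> t * max L \<kappa> \<le> 1 / 3"
    proof (cases "max L \<kappa> = 0")
      case False
      then have "0 < max L \<kappa>" using L0 by (simp add: max_def split: if_splits)
      then show ?thesis using lt by (simp add: one_ereal_def field_simps del: max_less_iff_conj less_max_iff_disj)
    qed simp
    moreover have "\<gamma> t * L \<le> \<gamma> t * max L \<kappa>" "\<gamma> t * \<kappa> \<le> \<gamma> t * max L \<kappa>"
      using g0 by (auto intro!: mult_left_mono)
    ultimately show "\<gamma> t * L \<le> 1 / 3" "\<gamma> t * \<kappa> \<le> 1 / 3" by linarith+
  qed
  \<comment> \<open>the integer times \<open>t \<ge> 1\<close> are counted from \<open>0\<close>, as \<open>t = Suc n\<close>\<close>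
  let ?F = "\<lambda>n. history M X (2 * Suc n)"
  let ?x = "\<lambda>n \<omega>. X (2 * Suc n) \<omega>"
  have filt: "discrete_filtration M ?F"
    unfolding discrete_filtration_def by (auto intro!: history_subalgebra history_mono Xm)
  define e where "e n = (6 * L * (\<gamma> (Suc n))\<^sup>2 * \<eta> (Suc n) + 9 * (\<eta> (Suc n))\<^sup>2) * (\<sigma>\<^sup>2 + \<kappa>\<^sup>2)" for n
  have e_summable: "summable e"
  proof -
    have "summable (\<lambda>t. (6 * L * ((\<gamma> t)\<^sup>2 * \<eta> t) + 9 * (\<eta> t)\<^sup>2) * (\<sigma>\<^sup>2 + \<kappa>\<^sup>2))"
      by (intro summable_mult2 summable_add summable_mult assms(11,12))
    then show ?thesis
      unfolding e_def
      by (subst (asm) summable_Suc_iff[symmetric]) (simp add: mult.assoc)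
  qed
  have e0: "0 \<le> e n" for n
    unfolding e_def using L0 assms(4)[of "Suc n"] by simp
  have rs: "AE \<omega> in M. convergent (\<lambda>n. (norm (?x n \<omega> - p))\<^sup>2)
      \<and> summable (\<lambda>n. \<gamma> (Suc n) * \<eta> (Suc n) / 2 * (norm (V (?x n \<omega>)))\<^sup>2)"
    if p: "V p = 0" for p
  proof (rule robbins_siegmund[OF fm filt _ _ _ _ e0 e_summable])
    fix n
    have [measurable]: "?x n \<in> borel_measurable (?F n)" by (rule measurable_history) simp_all
    show "(\<lambda>\<omega>. (norm (?x n \<omega> - p))\<^sup>2) \<in> borel_measurable (?F n)"
      "(\<lambda>\<omega>. \<gamma> (Suc n) * \<eta> (Suc n) / 2 * (norm (V (?x n \<omega>)))\<^sup>2) \<in> borel_measurable (?F n)"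
      by measurable
    show "0 \<le> (norm (?x n \<omega> - p))\<^sup>2" for \<omega> by simp
    have st: "0 < \<eta> (Suc n)" "\<eta> (Suc n) \<le> \<gamma> (Suc n)" using assms(4)[of "Suc n"] by auto
    then show "0 \<le> \<gamma> (Suc n) * \<eta> (Suc n) / 2 * (norm (V (?x n \<omega>)))\<^sup>2" for \<omega> by simp
    fix A assume A: "A \<in> sets (?F n)"
    show "(\<integral>\<^sup>+\<omega>\<in>A. ennreal ((norm (?x (Suc n) \<omega> - p))\<^sup>2
            + \<gamma> (Suc n) * \<eta> (Suc n) / 2 * (norm (V (?x n \<omega>)))\<^sup>2) \<partial>M)
        \<le> (\<integral>\<^sup>+\<omega>\<in>A. ennreal ((1 + e n) * (norm (?x n \<omega> - p))\<^sup>2 + e n) \<partial>M)"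
    proof (rule dseg_one_step[where G = "history M X (2 * Suc n + 1)" and F = "?F n"
          and y = "X (2 * Suc n + 1)" and z = "Z (2 * Suc n)" and z' = "Z (2 * Suc n + 1)"
          and L = L and \<sigma> = \<sigma> and \<kappa> = \<kappa>])
      show "subalgebra M (history M X (2 * Suc n + 1))" by (rule history_subalgebra[OF Xm])
      show "subalgebra (history M X (2 * Suc n + 1)) (?F n)" by (rule history_mono) simp
      show "X (2 * Suc n) \<in> borel_measurable (?F n)"
        "X (2 * Suc n + 1) \<in> borel_measurable (history M X (2 * Suc n + 1))"
        by (rule measurable_history; simp)+
      show "Z (2 * Suc n) \<in> borel_measurable M" "Z (2 * Suc n + 1) \<in> borel_measurable M"
        by (rule Zm; simp)+
      show "X (2 * Suc n + 1) \<omega> = ?x n \<omega> - \<gamma> (Suc n) *\<^sub>R (V (?x n \<omega>) + Z (2 * Suc n) \<omega>)"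
        if "\<omega> \<in> space M" for \<omega> by (rule half) (use that in auto)
      show "?x (Suc n) \<omega> = ?x n \<omega>
          - \<eta> (Suc n) *\<^sub>R (V (X (2 * Suc n + 1) \<omega>) + Z (2 * Suc n + 1) \<omega>)"
        if "\<omega> \<in> space M" for \<omega> using full[of "Suc n" \<omega>] that by simp
      show "\<gamma> (Suc n) * L \<le> 1 / 3" "\<gamma> (Suc n) * \<kappa> \<le> 1 / 3" by (rule small; simp)+
      have noise: "AE \<omega> in M. vec_cond_exp M (history M X k) (Z k) \<omega> = 0"
        "AE \<omega> in M. nn_cond_exp M (history M X k) (\<lambda>\<omega>. ennreal ((norm (Z k \<omega>))\<^sup>2)) \<omega>
           \<le> ennreal ((\<sigma> + \<kappa> * norm (X k \<omega> - p))\<^sup>2)" if "2 \<le> k" for k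
        using assms(8) that p unfolding oracle_noise_def by blast+
      show "AE \<omega> in M. vec_cond_exp M (?F n) (Z (2 * Suc n)) \<omega> = 0"
        "AE \<omega> in M. vec_cond_exp M (history M X (2 * Suc n + 1)) (Z (2 * Suc n + 1)) \<omega> = 0"
        "AE \<omega> in M. nn_cond_exp M (?F n) (\<lambda>\<omega>. ennreal ((norm (Z (2 * Suc n) \<omega>))\<^sup>2)) \<omega>
           \<le> ennreal ((\<sigma> + \<kappa> * norm (?x n \<omega> - p))\<^sup>2)"
        "AE \<omega> in M. nn_cond_exp M (history M X (2 * Suc n + 1))
             (\<lambda>\<omega>. ennreal ((norm (Z (2 * Suc n + 1) \<omega>))\<^sup>2)) \<omega>
           \<le> ennreal ((\<sigma> + \<kappa> * norm (X (2 * Suc n + 1) \<omega> - p))\<^sup>2)"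
        by (rule noise; simp)+
    qed (use fm assms(5,7,9) p st A in \<open>simp_all add: e_def\<close>)
  qed
  \<comment> \<open>the exceptional null set depends on \<open>p\<close>, so only countably many solutions can be treated at once\<close>
  obtain C where C: "countable C" "C \<subseteq> {x. V x = 0}" "{x. V x = 0} \<subseteq> closure C"
    by (rule separable)
  have "C \<noteq> {}" using C(3) assms(2) by auto
  have "AE \<omega> in M. \<forall>p\<in>C. convergent (\<lambda>n. (norm (?x n \<omega> - p))\<^sup>2)
      \<and> summable (\<lambda>n. \<gamma> (Suc n) * \<eta> (Suc n) / 2 * (norm (V (?x n \<omega>)))\<^sup>2)"
    using C(2) by (subst AE_ball_countable[OF C(1)]) (blast intro: rs)
  then have "AE \<omega> in M. \<exists>z. V z = 0 \<and> (\<lambda>n. ?x n \<omega>) \<longlonglongrightarrow> z"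
  proof (rule AE_mp, intro AE_I2 impI)
    fix \<omega>
    assume all: "\<forall>p\<in>C. convergent (\<lambda>n. (norm (?x n \<omega> - p))\<^sup>2)
      \<and> summable (\<lambda>n. \<gamma> (Suc n) * \<eta> (Suc n) / 2 * (norm (V (?x n \<omega>)))\<^sup>2)"
    show "\<exists>z. V z = 0 \<and> (\<lambda>n. ?x n \<omega>) \<longlonglongrightarrow> z"
    proof (rule convergent_if_quasi_fejer[OF contV \<open>C \<noteq> {}\<close> C(3)])
      fix p assume "p \<in> C"
      then have "convergent (\<lambda>n. (norm (?x n \<omega> - p))\<^sup>2)" using all by blast
      then have "convergent (\<lambda>n. sqrt ((norm (?x n \<omega> - p))\<^sup>2))"
        by (auto simp: convergent_def simp del: real_sqrt_abs real_sqrt_abs2 intro: tendsto_real_sqrt)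
      then show "convergent (\<lambda>n. norm (?x n \<omega> - p))" by simp
    next
      fix c :: real and m assume "0 < c"
      have "\<exists>n\<ge>m. (norm (V (?x n \<omega>)))\<^sup>2 / 2 < c\<^sup>2 / 2"
      proof (rule summable_weights_frequently_small)
        have "(\<Sum>t=1..T. \<gamma> t * \<eta> t) = (\<Sum>k<T. \<gamma> (Suc k) * \<eta> (Suc k))" for T
          by (simp add: sum.atLeast1_atMost_eq)
        then show "filterlim (\<lambda>n. \<Sum>k<n. \<gamma> (Suc k) * \<eta> (Suc k)) at_top sequentially"
          using assms(10) by simp
        show "0 \<le> \<gamma> (Suc n) * \<eta> (Suc n)" for n using assms(4)[of "Suc n"] by simp
        show "summable (\<lambda>n. \<gamma> (Suc n) * \<eta> (Suc n) * ((norm (V (?x n \<omega>)))\<^sup>2 / 2))"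
          using all \<open>C \<noteq> {}\<close> by auto
        show "0 < c\<^sup>2 / 2" using \<open>0 < c\<close> by simp
      qed
      then obtain n where "n \<ge> m" "(norm (V (?x n \<omega>)))\<^sup>2 < c\<^sup>2" by auto
      then show "\<exists>n\<ge>m. norm (V (?x n \<omega>)) < c"
        using \<open>0 < c\<close> power2_less_imp_less by (metis less_imp_le)
    qed
  qed
  then have conv: "AE \<omega> in M. V (lim (\<lambda>n. ?x n \<omega>)) = 0
      \<and> (\<lambda>t. X (2 * t) \<omega>) \<longlonglongrightarrow> lim (\<lambda>n. ?x n \<omega>)"
  proof (rule AE_mp, intro AE_I2 impI)
    fix \<omega> assume "\<exists>z. V z = 0 \<and> (\<lambda>n. ?x n \<omega>) \<longlonglongrightarrow> z"
    then obtain z where z: "V z = 0" "(\<lambda>n. ?x n \<omega>) \<longlonglongrightarrow> z" by blast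
    have "(\<lambda>t. X (2 * t) \<omega>) \<longlonglongrightarrow> z"
      using z(2) LIMSEQ_imp_Suc[of "\<lambda>t. X (2 * t) \<omega>"] by simp
    with z limI[OF z(2)] show "V (lim (\<lambda>n. ?x n \<omega>)) = 0
      \<and> (\<lambda>t. X (2 * t) \<omega>) \<longlonglongrightarrow> lim (\<lambda>n. ?x n \<omega>)" by simp
  qed
  have "(\<lambda>\<omega>. lim (\<lambda>n. ?x n \<omega>)) \<in> borel_measurable M"
    by (rule borel_measurable_lim_metric) (rule Xm, simp)
  with conv show ?thesis by (intro bexI) auto
qed

end
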